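(* Let $\mathcal{B}=\bigoplus_{n\ge0}\mathcal{B}_n$, where $\mathcal{B}_n$ is the complex vector space freely spanned by isomorphism classes of binary delta-matroids whose ground set has $n$ elements. With the multiplication given by direct sum, unit $(\emptyset;\{\emptyset\})$, comultiplication $\mu(D)=\sum_{E'\subseteq E}D_{E'}\otimes D_{E\setminus E'}$, and counit equal to the identification $\mathcal{B}_0\cong\mathbb{C}$ on $\mathcal{B}_0$ and zero on $\mathcal{B}_i$, $i\ge1$, the space $\mathcal{B}$ is a graded commutative cocommutative Hopf algebra. Moreover the subspace $\mathcal{B}^e\subseteq\mathcal{B}$ spanned by even binary delta-matroids is a Hopf subalgebra.
   Context: A set system $(E;\Phi)$ is a finite set $E$ with a nonempty family $\Phi\subseteq 2^E$ of feasible sets, considered up to isomorphism. For $E'\subseteq E$ the twist is $D*E'=(E;\{\phi\Delta E'\mid\phi\in\Phi\})$. A framed graph is a simple graph $G$ with a map $f:V(G)\to\{0,1\}$; its adjacency matrix over $\mathbb{F}_2$ has diagonal entry $f(v)$ at $v$ and the usual off-diagonal entries. The nondegeneracy delta-matroid of $G$ is $(V(G);\{U\subseteq V(G)\mid$ the adjacency matrix of the induced framed subgraph $G_U$ is nondegenerate over $\mathbb{F}_2\})$ (the empty matrix counts as nondegenerate). A binary delta-matroid is a set system isomorphic to a twist of the nondegeneracy delta-matroid of a framed graph. A delta-matroid is even if all feasible sets have cardinalities of the same parity. Direct sum of set systems with disjoint ground sets: $(E_1;\Phi_1)(E_2;\Phi_2)=(E_1\sqcup E_2;\{\phi_1\sqcup\phi_2\mid\phi_i\in\Phi_i\})$.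 For $D=(E;\Phi)$: $e$ is a coloop if it lies in every feasible set, a loop if in none; for non-coloop $e$, $D\setminus e=(E\setminus\{e\};\{\phi\in\Phi\mid e\notin\phi\})$; for non-loop $e$, $D/e=(E\setminus\{e\};\{\phi\setminus\{e\}\mid e\in\phi\in\Phi\})$; for a coloop $e$, $D\setminus e:=D/e$. The restriction $D_{E'}$ is obtained by deleting all elements of $E\setminus E'$. *)

theory Defs
  imports Main "HOL-Library.Z2" "Jordan_Normal_Form.Determinant"
begin

text \<open>A set system is a pair (E, Phi). We realise all set systems with ground sets
  that are finite sets of natural numbers; every finite set system is isomorphic to one of
  these, and we work with isomorphism classes anyway.\<close>

type_synonym ssys = "nat set \<times> nat set set"

definition set_system :: "ssys \<Rightarrow> bool" where
  "set_system D \<longleftrightarrow> finite (fst D) \<and> snd D \<noteq> {} \<and> snd D \<subseteq> Pow (fst D)"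

definition ss_iso :: "ssys \<Rightarrow> ssys \<Rightarrow> bool" where
  "ss_iso D1 D2 \<longleftrightarrow>
     (\<exists>f. bij_betw f (fst D1) (fst D2) \<and> snd D2 = (\<lambda>\<phi>. f ` \<phi>) ` snd D1)"

definition ss_class :: "ssys \<Rightarrow> ssys set" where
  "ss_class D = {D'. set_system D' \<and> ss_iso D D'}"

definition twist :: "ssys \<Rightarrow> nat set \<Rightarrow> ssys" where
  "twist D E' = (fst D, (\<lambda>\<phi>. (\<phi> - E') \<union> (E' - \<phi>)) ` snd D)"

text \<open>A framed graph: finite vertex set V, simple graph given by a symmetric irreflexive
  adjacency relation on V, and framing fr : V -> {0,1} (values in the field bit = F_2).\<close>
definition framed_graph :: "nat set \<Rightarrow> (nat \<Rightarrow> nat \<Rightarrow> bool) \<Rightarrow> bool" where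
  "framed_graph V adj \<longleftrightarrow> finite V \<and>
     (\<forall>v w. adj v w \<longrightarrow> v \<in> V \<and> w \<in> V) \<and>
     (\<forall>v w. adj v w \<longrightarrow> adj w v) \<and> (\<forall>v. \<not> adj v v)"

definition adj_matrix :: "(nat \<Rightarrow> nat \<Rightarrow> bool) \<Rightarrow> (nat \<Rightarrow> bit) \<Rightarrow> nat set \<Rightarrow> bit mat" where
  "adj_matrix adj fr U =
     (let xs = sorted_list_of_set U in
      mat (length xs) (length xs)
        (\<lambda>(i, j). if i = j then fr (xs ! i) else (if adj (xs ! i) (xs ! j) then 1 else 0)))"

definition nondeg_dm :: "nat set \<Rightarrow> (nat \<Rightarrow> nat \<Rightarrow> bool) \<Rightarrow> (nat \<Rightarrow> bit) \<Rightarrow> ssys" where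
  "nondeg_dm V adj fr = (V, {U. U \<subseteq> V \<and> det (adj_matrix adj fr U) \<noteq> 0})"

definition binary_dm :: "ssys \<Rightarrow> bool" where
  "binary_dm D \<longleftrightarrow> set_system D \<and>
     (\<exists>V adj fr E'. framed_graph V adj \<and> E' \<subseteq> V \<and> ss_iso (twist (nondeg_dm V adj fr) E') D)"

definition even_ss :: "ssys \<Rightarrow> bool" where
  "even_ss D \<longleftrightarrow> (\<forall>\<phi>\<in>snd D. \<forall>\<psi>\<in>snd D. even (card \<phi>) = even (card \<psi>))"

definition dsum :: "ssys \<Rightarrow> ssys \<Rightarrow> ssys" where
  "dsum D1 D2 = (fst D1 \<union> fst D2, {\<phi>1 \<union> \<phi>2 | \<phi>1 \<phi>2. \<phi>1 \<in> snd D1 \<and> \<phi>2 \<in> snd D2})"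

text \<open>Deletion of e: for a non-coloop the usual deletion; for a coloop it is the contraction.\<close>
definition del :: "nat \<Rightarrow> ssys \<Rightarrow> ssys" where
  "del e D =
     (if (\<forall>\<phi>\<in>snd D. e \<in> \<phi>) then (fst D - {e}, (\<lambda>\<phi>. \<phi> - {e}) ` snd D)
      else (fst D - {e}, {\<phi> \<in> snd D. e \<notin> \<phi>}))"

definition restr :: "ssys \<Rightarrow> nat set \<Rightarrow> ssys" where
  "restr D E' = fold del (sorted_list_of_set (fst D - E')) D"

type_synonym cls = "ssys set"

definition BDM :: "cls set" where
  "BDM = ss_class ` {D. binary_dm D}"

definition BDM_even :: "cls set" where
  "BDM_even = ss_class ` {D. binary_dm D \<and> even_ss D}"

definition rep :: "cls \<Rightarrow> ssys" where
  "rep C = (SOME D. D \<in> C)"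

definition deg :: "cls \<Rightarrow> nat" where
  "deg C = card (fst (rep C))"

definition cmult :: "cls \<Rightarrow> cls \<Rightarrow> cls" where
  "cmult C1 C2 = {D. \<exists>D1\<in>C1. \<exists>D2\<in>C2. fst D1 \<inter> fst D2 = {} \<and> set_system D \<and> ss_iso (dsum D1 D2) D}"

definition cunit :: cls where
  "cunit = ss_class ({}, {{}})"

text \<open>Coproduct of a basis element, as an element of B (x) B given by its coefficients
  on basis tensors A (x) B.\<close>
definition comult :: "cls \<Rightarrow> cls \<times> cls \<Rightarrow> complex" where
  "comult C p = of_nat (card {E'. E' \<subseteq> fst (rep C) \<and>
       ss_class (restr (rep C) E') = fst p \<and> ss_class (restr (rep C) (fst (rep C) - E')) = snd p})"

definition counit :: "cls \<Rightarrow> complex" where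
  "counit C = (if deg C = 0 then 1 else 0)"

definition supp :: "('x \<Rightarrow> complex) \<Rightarrow> 'x set" where
  "supp f = {x. f x \<noteq> 0}"

definition in_span :: "'x set \<Rightarrow> ('x \<Rightarrow> complex) \<Rightarrow> bool" where
  "in_span S f \<longleftrightarrow> finite (supp f) \<and> supp f \<subseteq> S"

text \<open>Product in B (x) B, by bilinear extension of the product of basis tensors.\<close>
definition tmult :: "('b \<Rightarrow> 'b \<Rightarrow> 'b) \<Rightarrow> ('b \<times> 'b \<Rightarrow> complex) \<Rightarrow> ('b \<times> 'b \<Rightarrow> complex) \<Rightarrow> 'b \<times> 'b \<Rightarrow> complex" where
  "tmult m x y r = (\<Sum>p\<in>supp x. \<Sum>q\<in>supp y.
       if m (fst p) (fst q) = fst r \<and> m (snd p) (snd q) = snd r then x p * y q else 0)"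

definition lmult :: "('b \<Rightarrow> 'b \<Rightarrow> 'b) \<Rightarrow> ('b \<Rightarrow> complex) \<Rightarrow> 'b \<Rightarrow> 'b \<Rightarrow> complex" where
  "lmult m y b z = (\<Sum>a\<in>supp y. if m a b = z then y a else 0)"

definition rmult :: "('b \<Rightarrow> 'b \<Rightarrow> 'b) \<Rightarrow> 'b \<Rightarrow> ('b \<Rightarrow> complex) \<Rightarrow> 'b \<Rightarrow> complex" where
  "rmult m b y z = (\<Sum>a\<in>supp y. if m b a = z then y a else 0)"

definition ind :: "'x \<Rightarrow> 'x \<Rightarrow> complex" where
  "ind a x = (if x = a then 1 else 0)"

text \<open>S : basis -> B is an antipode: m (S (x) id) Delta = eta epsilon = m (id (x) S) Delta.\<close>
definition is_antipode ::
  "'b set \<Rightarrow> ('b \<Rightarrow> 'b \<Rightarrow> 'b) \<Rightarrow> 'b \<Rightarrow> ('b \<Rightarrow> 'b \<times> 'b \<Rightarrow> complex) \<Rightarrow> ('b \<Rightarrow> complex)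
   \<Rightarrow> ('b \<Rightarrow> 'b \<Rightarrow> complex) \<Rightarrow> bool" where
  "is_antipode Bs m u \<Delta> \<epsilon> S \<longleftrightarrow>
     (\<forall>c\<in>Bs. in_span Bs (S c)) \<and>
     (\<forall>c\<in>Bs. \<forall>z. (\<Sum>p\<in>supp (\<Delta> c). \<Delta> c p * lmult m (S (fst p)) (snd p) z) = \<epsilon> c * ind u z) \<and>
     (\<forall>c\<in>Bs. \<forall>z. (\<Sum>p\<in>supp (\<Delta> c). \<Delta> c p * rmult m (fst p) (S (snd p)) z) = \<epsilon> c * ind u z)"

text \<open>The free vector space on the basis Bs, with multiplication the bilinear extension of m,
  unit u, comultiplication and counit the linear extensions of Delta, epsilon, is a graded
  (by deg) commutative cocommutative Hopf algebra.\<close>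
definition graded_comm_cocomm_hopf ::
  "'b set \<Rightarrow> ('b \<Rightarrow> 'b \<Rightarrow> 'b) \<Rightarrow> 'b \<Rightarrow> ('b \<Rightarrow> 'b \<times> 'b \<Rightarrow> complex) \<Rightarrow> ('b \<Rightarrow> complex)
   \<Rightarrow> ('b \<Rightarrow> nat) \<Rightarrow> bool" where
  "graded_comm_cocomm_hopf Bs m u \<Delta> \<epsilon> dg \<longleftrightarrow>
     \<comment> \<open>structure maps are well defined\<close>
     u \<in> Bs \<and>
     (\<forall>a\<in>Bs. \<forall>b\<in>Bs. m a b \<in> Bs) \<and>
     (\<forall>c\<in>Bs. in_span (Bs \<times> Bs) (\<Delta> c)) \<and>
     \<comment> \<open>associative unital algebra\<close>
     (\<forall>a\<in>Bs. \<forall>b\<in>Bs. \<forall>c\<in>Bs. m (m a b) c = m a (m b c)) \<and>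
     (\<forall>a\<in>Bs. m u a = a \<and> m a u = a) \<and>
     \<comment> \<open>coassociative counital coalgebra\<close>
     (\<forall>c\<in>Bs. \<forall>a b d.
        (\<Sum>p\<in>supp (\<Delta> c). \<Delta> c p * \<Delta> (fst p) (a, b) * ind d (snd p)) =
        (\<Sum>p\<in>supp (\<Delta> c). \<Delta> c p * ind a (fst p) * \<Delta> (snd p) (b, d))) \<and>
     (\<forall>c\<in>Bs. \<forall>b. (\<Sum>p\<in>supp (\<Delta> c). \<Delta> c p * \<epsilon> (fst p) * ind b (snd p)) = ind c b) \<and>
     (\<forall>c\<in>Bs. \<forall>a. (\<Sum>p\<in>supp (\<Delta> c). \<Delta> c p * ind a (fst p) * \<epsilon> (snd p)) = ind c a) \<and>
     \<comment> \<open>bialgebra compatibility\<close>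
     (\<forall>a\<in>Bs. \<forall>b\<in>Bs. \<Delta> (m a b) = tmult m (\<Delta> a) (\<Delta> b)) \<and>
     (\<forall>a\<in>Bs. \<forall>b\<in>Bs. \<epsilon> (m a b) = \<epsilon> a * \<epsilon> b) \<and>
     \<Delta> u = ind (u, u) \<and> \<epsilon> u = 1 \<and>
     \<comment> \<open>antipode\<close>
     (\<exists>S. is_antipode Bs m u \<Delta> \<epsilon> S) \<and>
     \<comment> \<open>graded\<close>
     dg u = 0 \<and>
     (\<forall>a\<in>Bs. \<forall>b\<in>Bs. dg (m a b) = dg a + dg b) \<and>
     (\<forall>c\<in>Bs. \<forall>p\<in>supp (\<Delta> c). dg (fst p) + dg (snd p) = dg c) \<and>
     (\<forall>c\<in>Bs. dg c > 0 \<longrightarrow> \<epsilon> c = 0) \<and>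
     \<comment> \<open>commutative and cocommutative\<close>
     (\<forall>a\<in>Bs. \<forall>b\<in>Bs. m a b = m b a) \<and>
     (\<forall>c\<in>Bs. \<forall>a b. \<Delta> c (a, b) = \<Delta> c (b, a))"

definition hopf_subalgebra ::
  "'b set \<Rightarrow> 'b set \<Rightarrow> ('b \<Rightarrow> 'b \<Rightarrow> 'b) \<Rightarrow> 'b \<Rightarrow> ('b \<Rightarrow> 'b \<times> 'b \<Rightarrow> complex) \<Rightarrow> ('b \<Rightarrow> complex)
   \<Rightarrow> bool" where
  "hopf_subalgebra Bs' Bs m u \<Delta> \<epsilon> \<longleftrightarrow>
     Bs' \<subseteq> Bs \<and> u \<in> Bs' \<and>
     (\<forall>a\<in>Bs'. \<forall>b\<in>Bs'. m a b \<in> Bs') \<and>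
     (\<forall>c\<in>Bs'. in_span (Bs' \<times> Bs') (\<Delta> c)) \<and>
     (\<forall>S. is_antipode Bs m u \<Delta> \<epsilon> S \<longrightarrow> (\<forall>c\<in>Bs'. in_span Bs' (S c)))"

end

theory Submission
  imports Defs
begin

text \<open>A binary delta-matroid on E is the set system of a Lagrangian subspace L of the symplectic
  space F_2^E + F_2^E: a set U is feasible iff L meets the coordinate Lagrangian of U trivially.
  The adjacency matrix of a framed graph gives its graph as L; conversely, after a twist by a feasible
  set, L is the graph of a symmetric matrix. Deletion of e, with the coloop convention, is symplectic
  reduction of L at e. Hence an iterated deletion depends only on the set of deleted elements and
  stays binary, and restriction is compatible with direct sums and isomorphisms. Coassociativity and
  multiplicativity of the comultiplication then reduce to reindexing sums over subsets. The antipode is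
  determined by recursion on the degree, which also shows that it preserves the even part, and
  commutativity with cocommutativity makes the left antipode a right one.\<close>

text \<open>The obstacle is the coloop convention: \<open>del\<close> branches on whether
  \<open>e\<close> is a coloop, and \<open>restr\<close> applies \<open>del\<close> in one fixed
  order, so proving directly on set families that deletions commute and stay binary means a case
  analysis at every step. For Lagrangians the branching disappears. Deleting \<open>e\<close> keeps
  the vectors of \<open>L\<close> with \<open>v (e, True) = 0\<close> and forgets their coordinates
  at \<open>e\<close>. If the unit vector at \<open>(e, False)\<close> lies in \<open>L\<close>,
  then \<open>e\<close> is a coloop, every vector of \<open>L\<close> already satisfies the
  condition, and the result is the contraction. Otherwise the result consists of the feasible sets
  avoiding \<open>e\<close>; the delicate point is that one exists, so that \<open>del\<close> takes
  the same branch. Iterated reductions compose to a formula that mentions only the set of remaining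
  elements. Maximality of \<open>L\<close> is expressed by orthogonality instead of dimension, so
  every membership in \<open>L\<close> is proved by pairing with the vectors of
  \<open>L\<close>.\<close>

subsection \<open>Lagrangian subspaces and their set systems\<close>

text \<open>These simp rules turn field arithmetic on bit into bit operations, out of reach of
  algebra_simps.\<close>

declare add_bit_eq_xor [simp del] mult_bit_eq_and [simp del]

lemma bit_add_self [simp]: "(x::bit) + x = 0"
  by (cases x) simp_all

lemma bit_add_eq_0_iff: "(x::bit) + y = 0 \<longleftrightarrow> x = y"
  by (cases x; cases y) simp_all

text \<open>A vector has coordinates v (e, True) in the first and v (e, False) in the second copy of F_2^E.
  Only coordinates at elements of E matter: a Lagrangian for E contains with v every vector that agrees
  with v on E. Thus the Lagrangian of a direct sum is simply an intersection.\<close>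

type_synonym vct = "nat \<times> bool \<Rightarrow> bit"

text \<open>The standard symplectic form; in characteristic 2 the sign disappears and the form is
  symmetric.\<close>

definition pairing :: "nat set \<Rightarrow> vct \<Rightarrow> vct \<Rightarrow> bit" where
  "pairing E v w = (\<Sum>e\<in>E. v (e, True) * w (e, False) + v (e, False) * w (e, True))"

text \<open>Being one's own orthogonal complement replaces "isotropic of dimension |E|". This single
  equation yields closure under sums, the zero vector and the freedom of all coordinates outside
  \<open>E\<close>.\<close>

definition lagrangian :: "nat set \<Rightarrow> vct set \<Rightarrow> bool" where
  "lagrangian E L \<longleftrightarrow> L = {v. \<forall>w\<in>L. pairing E v w = 0}"

text \<open>The coordinate Lagrangian of \<open>U\<close> is spanned by the unit vectors at
  \<open>(e, True)\<close> for \<open>e\<close> in \<open>U\<close> and at \<open>(e, False)\<close>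
  for the other \<open>e\<close>. Lying in it means that the coordinate
  \<open>(e, e \<notin> U)\<close> vanishes for each \<open>e\<close>. "Trivially" means zero on
  \<open>E\<close>, since coordinates elsewhere are free.\<close>

definition lag_dm :: "nat set \<Rightarrow> vct set \<Rightarrow> ssys" where
  "lag_dm E L = (E, {U. U \<subseteq> E \<and>
     (\<forall>v\<in>L. (\<forall>e\<in>E. v (e, e \<notin> U) = 0) \<longrightarrow> (\<forall>e\<in>E. \<forall>b. v (e, b) = 0))})"

lemma fst_lag_dm [simp]: "fst (lag_dm E L) = E"
  by (simp add: lag_dm_def)

lemma mem_lag_dm: "U \<in> snd (lag_dm E L) \<longleftrightarrow> U \<subseteq> E \<and>
     (\<forall>v\<in>L. (\<forall>e\<in>E. v (e, e \<notin> U) = 0) \<longrightarrow> (\<forall>e\<in>E. \<forall>b. v (e, b) = 0))"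
  by (simp add: lag_dm_def)

lemma pairing_cong:
  assumes "\<And>e b. e \<in> E \<Longrightarrow> v (e, b) = v' (e, b)" "\<And>e b. e \<in> E \<Longrightarrow> w (e, b) = w' (e, b)"
  shows "pairing E v w = pairing E v' w'"
  unfolding pairing_def using assms by (intro sum.cong) auto

lemma pairing_commute: "pairing E v w = pairing E w v"
  unfolding pairing_def by (intro sum.cong) (auto simp: ac_simps)

lemma pairing_add_left: "pairing E (\<lambda>p. u p + v p) w = pairing E u w + pairing E v w"
  unfolding pairing_def by (simp add: sum.distrib[symmetric] algebra_simps)

lemma pairing_zero:
  assumes "\<And>e b. e \<in> E \<Longrightarrow> v (e, b) = 0"
  shows "pairing E v w = 0"
  unfolding pairing_def using assms by (simp add: sum.neutral)

lemma pairing_insert: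
  assumes "finite E" "e \<in> E"
  shows "pairing E v w = v (e, True) * w (e, False) + v (e, False) * w (e, True) + pairing (E - {e}) v w"
  unfolding pairing_def using assms by (simp add: sum.remove)

lemma pairing_single:
  assumes "finite E" "e \<in> E" "\<And>d. d \<in> E \<Longrightarrow> v (d, True) = (if d = e then 1 else 0)"
  shows "pairing E v w = w (e, False) + (\<Sum>d\<in>E. v (d, False) * w (d, True))"
proof -
  have "(\<Sum>d\<in>E. v (d, True) * w (d, False)) = (\<Sum>d\<in>E. if d = e then w (d, False) else 0)"
    using assms by (intro sum.cong) auto
  also have "\<dots> = w (e, False)" using assms by simp
  finally show ?thesis by (simp add: pairing_def sum.distrib)
qed

lemma lagrangian_mem: "lagrangian E L \<Longrightarrow> v \<in> L \<longleftrightarrow> (\<forall>w\<in>L. pairing E v w = 0)"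
  unfolding lagrangian_def by blast

lemma lagrangianI:
  assumes "\<And>v w. v \<in> L \<Longrightarrow> w \<in> L \<Longrightarrow> pairing E v w = 0"
    and "\<And>v. (\<And>w. w \<in> L \<Longrightarrow> pairing E v w = 0) \<Longrightarrow> v \<in> L"
  shows "lagrangian E L"
  unfolding lagrangian_def using assms by blast

lemma lagrangian_isotropic:
  "lagrangian E L \<Longrightarrow> v \<in> L \<Longrightarrow> w \<in> L \<Longrightarrow> pairing E v w = 0"
  using lagrangian_mem by blast

lemma lagrangian_cong:
  assumes "lagrangian E L" "v \<in> L" "\<And>e b. e \<in> E \<Longrightarrow> w (e, b) = v (e, b)"
  shows "w \<in> L"
  unfolding lagrangian_mem[OF assms(1)]
  using assms lagrangian_mem[OF assms(1), of v] pairing_cong[of E w v] by simp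

lemma lagrangian_add:
  assumes "lagrangian E L" "v \<in> L" "w \<in> L"
  shows "(\<lambda>p. v p + w p) \<in> L"
  unfolding lagrangian_mem[OF assms(1)]
  using assms by (simp add: lagrangian_isotropic pairing_add_left)

lemma lagrangian_zero:
  assumes "lagrangian E L" "\<And>e b. e \<in> E \<Longrightarrow> v (e, b) = 0"
  shows "v \<in> L"
  unfolding lagrangian_mem[OF assms(1)] using assms(2) by (simp add: pairing_zero)

text \<open>Orthogonal complements reverse inclusions, and both sides are their own complements.
  This takes the place of a comparison of dimensions.\<close>

lemma lagrangian_subset_eq:
  assumes "lagrangian E L" "lagrangian E M" "L \<subseteq> M"
  shows "L = M"
  using assms lagrangian_mem[of E L] lagrangian_mem[of E M] by blast

text \<open>The symplectic involution that exchanges the two coordinates at each element of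
  \<open>T\<close>: comparing \<open>b\<close> with \<open>e \<in> T\<close> by inequality is
  exclusive or.\<close>

definition lag_twist :: "nat set \<Rightarrow> vct set \<Rightarrow> vct set" where
  "lag_twist T L = {w. (\<lambda>(e, b). w (e, b \<noteq> (e \<in> T))) \<in> L}"

lemma pairing_twist:
  "pairing E (\<lambda>(e, b). v (e, b \<noteq> (e \<in> T))) (\<lambda>(e, b). w (e, b \<noteq> (e \<in> T))) = pairing E v w"
  unfolding pairing_def
proof (intro sum.cong refl)
  fix e
  show "(case (e, True) of (e, b) \<Rightarrow> v (e, b \<noteq> (e \<in> T))) * (case (e, False) of (e, b) \<Rightarrow> w (e, b \<noteq> (e \<in> T))) +
      (case (e, False) of (e, b) \<Rightarrow> v (e, b \<noteq> (e \<in> T))) * (case (e, True) of (e, b) \<Rightarrow> w (e, b \<noteq> (e \<in> T))) =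
      v (e, True) * w (e, False) + v (e, False) * w (e, True)"
    by (cases "e \<in> T") (simp_all add: add.commute)
qed

lemma twist_vct_twice:
  "(\<lambda>(e, b). (\<lambda>(e, b). w (e, b \<noteq> (e \<in> T))) (e, b \<noteq> (e \<in> T))) = (w :: vct)"
proof
  fix p :: "nat \<times> bool"
  show "(case p of (e, b) \<Rightarrow> (\<lambda>(e, b). w (e, b \<noteq> (e \<in> T))) (e, b \<noteq> (e \<in> T))) = w p"
    by (cases p; cases "fst p \<in> T") simp_all
qed

lemma lag_twist_twice: "lag_twist T (lag_twist T L) = L"
  unfolding lag_twist_def mem_Collect_eq twist_vct_twice by simp

lemma lagrangian_twist:
  assumes "lagrangian E L" shows "lagrangian E (lag_twist T L)"
proof -
  let ?t = "\<lambda>w::vct. (\<lambda>(e, b). w (e, b \<noteq> (e \<in> T)))"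
  have tt: "?t (?t w) = w" for w by (rule twist_vct_twice)
  have m: "v \<in> lag_twist T L \<longleftrightarrow> ?t v \<in> L" for v by (simp add: lag_twist_def)
  show ?thesis
  proof (rule lagrangianI)
    fix v w assume "v \<in> lag_twist T L" "w \<in> lag_twist T L"
    then show "pairing E v w = 0"
      using lagrangian_isotropic[OF assms, of "?t v" "?t w"] by (simp only: m pairing_twist)
  next
    fix v assume v: "\<And>w. w \<in> lag_twist T L \<Longrightarrow> pairing E v w = 0"
    have "pairing E (?t v) w = 0" if "w \<in> L" for w
    proof -
      have "pairing E v (?t w) = 0" using that by (intro v) (simp only: m tt)
      then have "pairing E (?t v) (?t (?t w)) = 0" by (simp only: pairing_twist)
      then show ?thesis by (simp only: tt)
    qed
    then show "v \<in> lag_twist T L" unfolding m using lagrangian_mem[OF assms] by blast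
  qed
qed

lemma mem_twist: "U \<in> snd (twist D T) \<longleftrightarrow> (U - T) \<union> (T - U) \<in> snd D"
proof -
  have "((U - T) \<union> (T - U) - T) \<union> (T - ((U - T) \<union> (T - U))) = U" for U :: "nat set" by blast
  then show ?thesis unfolding twist_def snd_conv by (intro iffI) (auto intro: rev_image_eqI)
qed

text \<open>Exchanging coordinates at \<open>T\<close> carries the coordinate Lagrangian of
  \<open>U\<close> to that of the symmetric difference of \<open>U\<close> and \<open>T\<close>.
  Only one direction is stated; the involution supplies the other.\<close>

lemma lag_dm_twist_subset:
  assumes "T \<subseteq> E" "U \<in> snd (lag_dm E L)"
  shows "(U - T) \<union> (T - U) \<in> snd (lag_dm E (lag_twist T L))"
  unfolding mem_lag_dm
proof (intro conjI ballI impI allI)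
  show "U - T \<union> (T - U) \<subseteq> E" using assms by (auto simp: mem_lag_dm)
  fix v e b assume v: "v \<in> lag_twist T L" and z: "\<forall>e\<in>E. v (e, e \<notin> U - T \<union> (T - U)) = 0" and e: "e \<in> E"
  let ?w = "\<lambda>(e, b). v (e, b \<noteq> (e \<in> T))"
  have "?w \<in> L" using v by (simp add: lag_twist_def)
  moreover have "?w (e, e \<notin> U) = 0" if "e \<in> E" for e
    using z that by (cases "e \<in> T"; cases "e \<in> U"; force)
  ultimately have "\<forall>b. ?w (e, b) = 0" using assms(2) e unfolding mem_lag_dm by blast
  from this[rule_format, of "b \<noteq> (e \<in> T)"] show "v (e, b) = 0"
    by (cases "e \<in> T"; cases b) auto
qed

lemma lag_dm_twist:
  assumes "T \<subseteq> E" shows "lag_dm E (lag_twist T L) = twist (lag_dm E L) T"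
proof (intro prod_eqI)
  show "fst (lag_dm E (lag_twist T L)) = fst (twist (lag_dm E L) T)" by (simp add: twist_def)
  have id: "((U - T) \<union> (T - U) - T) \<union> (T - ((U - T) \<union> (T - U))) = U" for U by blast
  show "snd (lag_dm E (lag_twist T L)) = snd (twist (lag_dm E L) T)"
  proof (rule Set.set_eqI)
    fix U
    show "U \<in> snd (lag_dm E (lag_twist T L)) \<longleftrightarrow> U \<in> snd (twist (lag_dm E L) T)"
      unfolding mem_twist
      using lag_dm_twist_subset[OF assms, of U "lag_twist T L"]
        lag_dm_twist_subset[OF assms, of "(U - T) \<union> (T - U)" L]
      by (auto simp only: lag_twist_twice id)
  qed
qed

definition graph_lag :: "nat set \<Rightarrow> (nat \<Rightarrow> nat \<Rightarrow> bit) \<Rightarrow> vct set" where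
  "graph_lag E A = {v. \<forall>e\<in>E. v (e, False) = (\<Sum>d\<in>E. A e d * v (d, True))}"

text \<open>Isotropy holds because symmetry of \<open>A\<close> makes the two double sums equal, so
  they cancel in characteristic 2.\<close>

lemma lagrangian_graph:
  assumes fin: "finite E" and sym: "\<And>e d. e \<in> E \<Longrightarrow> d \<in> E \<Longrightarrow> A e d = A d e"
  shows "lagrangian E (graph_lag E A)"
proof (rule lagrangianI)
  fix v w assume v: "v \<in> graph_lag E A" and w: "w \<in> graph_lag E A"
  have "pairing E v w = (\<Sum>e\<in>E. \<Sum>d\<in>E. A e d * v (e, True) * w (d, True))
      + (\<Sum>e\<in>E. \<Sum>d\<in>E. A e d * v (d, True) * w (e, True))"
    using v w unfolding pairing_def graph_lag_def
    by (simp add: sum.distrib sum_distrib_left sum_distrib_right ac_simps)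
  also have "(\<Sum>e\<in>E. \<Sum>d\<in>E. A e d * v (d, True) * w (e, True))
      = (\<Sum>e\<in>E. \<Sum>d\<in>E. A e d * v (e, True) * w (d, True))"
    by (subst sum.swap) (intro sum.cong refl, simp add: sym)
  finally show "pairing E v w = 0" by simp
next
  fix v assume v: "\<And>w. w \<in> graph_lag E A \<Longrightarrow> pairing E v w = 0"
  show "v \<in> graph_lag E A"
    unfolding graph_lag_def
  proof (intro CollectI ballI)
    fix e assume e: "e \<in> E"
    \<comment> \<open>The point of the graph over the unit vector at \<open>e\<close>, that is,
      column \<open>e\<close> of \<open>A\<close>. Pairing \<open>v\<close> with it gives exactly
      the equation of row \<open>e\<close>.\<close>
    define w :: vct where "w = (\<lambda>(d, b). if b then (if d = e then 1 else 0) else A d e)"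
    have "w \<in> graph_lag E A" unfolding graph_lag_def w_def
    proof (intro CollectI ballI)
      fix d assume "d \<in> E"
      have "(\<Sum>c\<in>E. A d c * (if c = e then 1 else 0)) = (\<Sum>c\<in>E. if c = e then A d c else 0)"
        by (intro sum.cong) auto
      also have "\<dots> = A d e" using fin e by simp
      finally show "(case (d, False) of (d, b) \<Rightarrow> if b then if d = e then 1 else 0 else A d e) =
         (\<Sum>c\<in>E. A d c * (case (c, True) of (d, b) \<Rightarrow> if b then if d = e then 1 else 0 else A d e))"
        by simp
    qed
    from v[OF this] have "pairing E w v = 0" by (simp add: pairing_commute)
    moreover have "pairing E w v = v (e, False) + (\<Sum>d\<in>E. A e d * v (d, True))"
      using pairing_single[OF fin e, of w v] sym[OF e] by (simp add: w_def)
    ultimately show "v (e, False) = (\<Sum>d\<in>E. A e d * v (d, True))"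
      by (simp add: bit_add_eq_0_iff)
  qed
qed

text \<open>Induction on E, looking at the vectors of S that vanish at the new index: either they have an
  annihilator, which extends by a suitable value at that index, or they fill the whole space.\<close>

lemma annihilator_exists:
  fixes S :: "('a \<Rightarrow> bit) set"
  assumes "finite E" "(\<lambda>_. 0) \<in> S" "\<And>s t. s \<in> S \<Longrightarrow> t \<in> S \<Longrightarrow> (\<lambda>e. s e + t e) \<in> S"
    and "\<not> (\<forall>x. \<exists>s\<in>S. \<forall>e\<in>E. s e = x e)"
  shows "\<exists>z. (\<exists>e\<in>E. z e \<noteq> 0) \<and> (\<forall>s\<in>S. (\<Sum>e\<in>E. s e * z e) = 0)"
  using assms
proof (induction E arbitrary: S rule: finite_induct)
  case empty
  then show ?case by blast
next
  case (insert a E)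
  define S0 where "S0 = {s\<in>S. s a = 0}"
  have S0: "(\<lambda>_. 0) \<in> S0" "\<And>s t. s \<in> S0 \<Longrightarrow> t \<in> S0 \<Longrightarrow> (\<lambda>e. s e + t e) \<in> S0"
    using insert.prems unfolding S0_def by auto
  have upd: "(\<Sum>e\<in>insert a E. s e * (z(a := c)) e) = s a * c + (\<Sum>e\<in>E. s e * z e)" for s z c
  proof -
    have "(\<Sum>e\<in>E. s e * (z(a := c)) e) = (\<Sum>e\<in>E. s e * z e)"
      using insert.hyps by (intro sum.cong) auto
    then show ?thesis using insert.hyps by simp
  qed
  show ?case
  proof (cases "\<forall>x. \<exists>s\<in>S0. \<forall>e\<in>E. s e = x e")
    case False
    from insert.IH[OF S0 False] obtain z where z: "\<exists>e\<in>E. z e \<noteq> 0"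
      "\<And>s. s \<in> S0 \<Longrightarrow> (\<Sum>e\<in>E. s e * z e) = 0" by blast
    have nz: "\<exists>e\<in>insert a E. (z(a := c)) e \<noteq> 0" for c
      using z(1) insert.hyps by force
    show ?thesis
    proof (cases "\<exists>l\<in>S. l a = 1")
      case True
      then obtain l where l: "l \<in> S" "l a = 1" by blast
      \<comment> \<open>The value at \<open>a\<close> is forced by \<open>l\<close>: in the extended
        sum for \<open>l\<close> it appears twice and cancels. Any other vector with value 1 at
        \<open>a\<close> differs from \<open>l\<close> by a vector of \<open>S0\<close>, which
        \<open>z\<close> annihilates.\<close>
      let ?c = "\<Sum>e\<in>E. l e * z e"
      have "s a * ?c + (\<Sum>e\<in>E. s e * z e) = 0" if "s \<in> S" for s
      proof (cases "s a = 0")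
        case True
        then show ?thesis using z(2)[of s] that by (simp add: S0_def)
      next
        case False
        then have "(\<lambda>e. s e + l e) \<in> S0"
          using insert.prems(2)[OF that l(1)] l by (simp add: S0_def)
        from z(2)[OF this] False show ?thesis
          by (simp add: algebra_simps sum.distrib)
      qed
      then show ?thesis using nz[of ?c] upd[of _ z ?c] by (intro exI[of _ "z(a := ?c)"]) simp
    next
      case False
      then have "S0 = S" unfolding S0_def by auto
      then have "s a * 0 + (\<Sum>e\<in>E. s e * z e) = 0" if "s \<in> S" for s
        using z(2) that by simp
      then show ?thesis using nz[of 0] upd[of _ z 0] by (intro exI[of _ "z(a := 0)"]) simp
    qed
  next
    case full: True
    show ?thesis
    proof (cases "\<exists>l\<in>S. l a = 1")
      case True
      then obtain l where l: "l \<in> S" "l a = 1" by blast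
      have "\<exists>s\<in>S. \<forall>e\<in>insert a E. s e = x e" for x
      proof (cases "x a = 0")
        case True
        then show ?thesis using full[rule_format, of x] by (auto simp: S0_def)
      next
        case False
        from full[rule_format, of "\<lambda>e. x e + l e"]
        obtain s where s: "s \<in> S0" "\<forall>e\<in>E. s e = x e + l e" by blast
        have "(\<lambda>e. s e + l e) \<in> S" using insert.prems(2) s l by (simp add: S0_def)
        moreover have "\<forall>e\<in>insert a E. s e + l e = x e"
          using s l False by (simp add: S0_def add.assoc)
        ultimately show ?thesis by (intro bexI[of _ "\<lambda>e. s e + l e"])
      qed
      then show ?thesis using insert.prems(3) by blast
    next
      case False
      then have "S0 = S" unfolding S0_def by auto
      then have "(\<Sum>e\<in>insert a E. s e * ((\<lambda>_. 0)(a := 1)) e) = 0" if "s \<in> S" for s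
        unfolding upd using that by (auto simp: S0_def)
      then show ?thesis by (intro exI[of _ "(\<lambda>_. 0)(a := 1)"]) simp
    qed
  qed
qed

text \<open>Feasibility of the empty set says that projecting \<open>L\<close> to the
  \<open>True\<close> coordinates is injective. Self-orthogonality then makes the projection
  surjective as well, and the lifts of the unit vectors give the matrix.\<close>

lemma lagrangian_is_graph:
  assumes fin: "finite E" and L: "lagrangian E L" and emp: "{} \<in> snd (lag_dm E L)"
  obtains A where "\<And>e d. e \<in> E \<Longrightarrow> d \<in> E \<Longrightarrow> A e d = A d e" "L = graph_lag E A"
proof -
  have inj: "v (e, b) = 0" if "v \<in> L" "\<forall>e\<in>E. v (e, True) = 0" "e \<in> E" for v e b
    using emp that unfolding mem_lag_dm by auto
  let ?S = "(\<lambda>v e. v (e, True)) ` L"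
  have "\<forall>x. \<exists>s\<in>?S. \<forall>e\<in>E. s e = x e"
  proof (rule ccontr)
    assume no: "\<not> ?thesis"
    have 0: "(\<lambda>_. 0) \<in> ?S" using lagrangian_zero[OF L, of "\<lambda>_. 0"] by force
    have add: "(\<lambda>e. s e + t e) \<in> ?S" if "s \<in> ?S" "t \<in> ?S" for s t
      using that lagrangian_add[OF L] by force
    obtain z where z: "\<exists>e\<in>E. z e \<noteq> 0" "\<forall>s\<in>?S. (\<Sum>e\<in>E. s e * z e) = 0"
      using annihilator_exists[OF fin 0 add no] by blast
    \<comment> \<open>A nonzero annihilator of the projection, placed in the \<open>False\<close>
      coordinates, is orthogonal to all of \<open>L\<close> and so lies in \<open>L\<close>. It
      projects to zero, against injectivity.\<close>
    let ?v = "\<lambda>(e, b). if b then 0 else z e"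
    have "?v \<in> L" unfolding lagrangian_mem[OF L]
      using z(2) by (auto simp: pairing_def mult.commute)
    from inj[OF this, of _ False] z(1) show False by auto
  qed
  then have "\<exists>v\<in>L. \<forall>d\<in>E. v (d, True) = (if d = e then 1 else 0)" for e
    by (drule_tac x = "\<lambda>d. if d = e then 1 else 0" in spec) auto
  then have "\<forall>e. \<exists>v. v \<in> L \<and> (\<forall>d\<in>E. v (d, True) = (if d = e then 1 else 0))" by blast
  from choice[OF this] obtain a where a: "\<And>e. a e \<in> L"
    "\<And>e d. d \<in> E \<Longrightarrow> a e (d, True) = (if d = e then 1 else 0)" by blast
  define A where "A e d = a e (d, False)" for e d
  \<comment> \<open>Pairing \<open>v\<close> with the lift \<open>a e\<close> isolates
    \<open>v (e, False)\<close>. Applied to \<open>v = a d\<close>, the same identity gives the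
    symmetry of \<open>A\<close>.\<close>
  have key: "v (e, False) = (\<Sum>d\<in>E. A e d * v (d, True))" if "v \<in> L" "e \<in> E" for v e
    using lagrangian_isotropic[OF L a(1) that(1), of e] pairing_single[OF fin that(2), of "a e" v] a(2)
    by (simp add: A_def bit_add_eq_0_iff)
  have sym: "A e d = A d e" if "e \<in> E" "d \<in> E" for e d
  proof -
    have "A d e = a d (e, False)" by (simp add: A_def)
    also have "\<dots> = (\<Sum>c\<in>E. if c = d then A e c else 0)"
      unfolding key[OF a(1) that(1)] using a(2) by (intro sum.cong) auto
    also have "\<dots> = A e d" using fin that by simp
    finally show ?thesis ..
  qed
  moreover have "L = graph_lag E A"
    using key by (intro lagrangian_subset_eq[OF L lagrangian_graph[OF fin sym]])
      (auto simp: graph_lag_def)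
  ultimately show ?thesis by (rule that)
qed

subsection \<open>Binary delta-matroids as set systems of Lagrangians\<close>

text \<open>\<open>adj_matrix\<close> is indexed by positions in the sorted list of
  \<open>U\<close>. Passing from the determinant to the kernel gives a condition indexed by
  \<open>U\<close> itself, in which the ordering no longer occurs.\<close>

lemma det_adj_matrix:
  fixes fr :: "nat \<Rightarrow> bit" and adj :: "nat \<Rightarrow> nat \<Rightarrow> bool"
  assumes fin: "finite U"
  defines "A \<equiv> \<lambda>e d. if e = d then fr e else if adj e d then 1 else 0"
  shows "det (adj_matrix adj fr U) \<noteq> 0 \<longleftrightarrow>
    (\<forall>x. (\<forall>e\<in>U. (\<Sum>d\<in>U. A e d * x d) = 0) \<longrightarrow> (\<forall>e\<in>U. x e = 0))"
proof -
  define xs where "xs = sorted_list_of_set U"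
  define n where "n = length xs"
  define M where "M = adj_matrix adj fr U"
  have dist: "distinct xs" and set: "set xs = U" using fin by (auto simp: xs_def)
  have bij: "bij_betw ((!) xs) {..<n} U" using dist set by (auto simp: n_def intro!: bij_betw_nth)
  have Mc: "M \<in> carrier_mat n n" by (simp add: M_def adj_matrix_def n_def xs_def Let_def)
  have M: "M $$ (i, j) = A (xs ! i) (xs ! j)" if "i < n" "j < n" for i j
    using that dist by (simp add: M_def adj_matrix_def n_def xs_def Let_def A_def nth_eq_iff_index_eq)
  have Mv: "(M *\<^sub>v v) $ i = (\<Sum>d\<in>U. A (xs ! i) d * x d)"
    if "i < n" "v \<in> carrier_vec n" "\<And>j. j < n \<Longrightarrow> x (xs ! j) = v $ j" for v x i
  proof -
    have "(M *\<^sub>v v) $ i = (\<Sum>j\<in>{..<n}. A (xs ! i) (xs ! j) * x (xs ! j))"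
      using that Mc M by (auto simp: scalar_prod_def lessThan_atLeast0 intro!: sum.cong)
    also have "\<dots> = (\<Sum>d\<in>U. A (xs ! i) d * x d)" by (rule sum.reindex_bij_betw[OF bij])
    finally show ?thesis .
  qed
  have "det M = 0 \<longleftrightarrow> (\<exists>x. (\<forall>e\<in>U. (\<Sum>d\<in>U. A e d * x d) = 0) \<and> (\<exists>e\<in>U. x e \<noteq> 0))"
    unfolding det_0_iff_vec_prod_zero_field[OF Mc]
  proof (intro iffI)
    assume "\<exists>v. v \<in> carrier_vec n \<and> v \<noteq> 0\<^sub>v n \<and> M *\<^sub>v v = 0\<^sub>v n"
    then obtain v where v: "v \<in> carrier_vec n" "v \<noteq> 0\<^sub>v n" "M *\<^sub>v v = 0\<^sub>v n" by blast
    define x where "x d = v $ (the_inv_into {..<n} ((!) xs) d)" for d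
    have x: "x (xs ! j) = v $ j" if "j < n" for j
      using the_inv_into_f_f[OF bij_betw_imp_inj_on[OF bij], of j] that by (simp add: x_def)
    have "(\<Sum>d\<in>U. A e d * x d) = 0" if "e \<in> U" for e
    proof -
      from that obtain i where "i < n" "e = xs ! i" using bij unfolding bij_betw_def by blast
      then show ?thesis using Mv[OF _ v(1) x] v(3) by force
    qed
    moreover have "\<exists>e\<in>U. x e \<noteq> 0"
    proof -
      obtain j where "j < n" "v $ j \<noteq> 0" using v(1,2) by (metis eq_vecI carrier_vecD index_zero_vec)
      then show ?thesis using x[of j] bij unfolding bij_betw_def by (intro bexI[of _ "xs ! j"]) auto
    qed
    ultimately show "\<exists>x. (\<forall>e\<in>U. (\<Sum>d\<in>U. A e d * x d) = 0) \<and> (\<exists>e\<in>U. x e \<noteq> 0)" by blast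
  next
    assume "\<exists>x. (\<forall>e\<in>U. (\<Sum>d\<in>U. A e d * x d) = 0) \<and> (\<exists>e\<in>U. x e \<noteq> 0)"
    then obtain x e where x: "\<And>e. e \<in> U \<Longrightarrow> (\<Sum>d\<in>U. A e d * x d) = 0" and e: "e \<in> U" "x e \<noteq> 0"
      by blast
    define v where "v = vec n (\<lambda>i. x (xs ! i))"
    have vc: "v \<in> carrier_vec n" by (simp add: v_def)
    from e obtain i where "i < n" "e = xs ! i" using bij unfolding bij_betw_def by blast
    then have "v $ i \<noteq> 0\<^sub>v n $ i" using e by (simp add: v_def)
    then have "v \<noteq> 0\<^sub>v n" by metis
    moreover have "M *\<^sub>v v = 0\<^sub>v n"
    proof (intro eq_vecI)
      fix i assume "i < dim_vec (0\<^sub>v n)"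
      then have i: "i < n" by simp
      then have "xs ! i \<in> U" using bij unfolding bij_betw_def by blast
      then show "(M *\<^sub>v v) $ i = 0\<^sub>v n $ i" using Mv[OF i vc, of x] x i by (simp add: v_def)
    qed (use Mc in simp)
    ultimately show "\<exists>v. v \<in> carrier_vec n \<and> v \<noteq> 0\<^sub>v n \<and> M *\<^sub>v v = 0\<^sub>v n" using vc by blast
  qed
  then show ?thesis unfolding M_def by blast
qed

text \<open>Let \<open>x\<close> be the \<open>True\<close> part of a vector of the graph. The
  condition at elements outside \<open>U\<close> says that \<open>x\<close> is supported on
  \<open>U\<close>; the condition at elements of \<open>U\<close> says that \<open>A x\<close>
  vanishes there. The nontrivial intersections are thus the nonzero kernel vectors of the principal
  submatrix on \<open>U\<close>.\<close>

lemma nondeg_dm_eq_lag_dm: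
  assumes fin: "finite V"
  shows "nondeg_dm V adj fr =
    lag_dm V (graph_lag V (\<lambda>e d. if e = d then fr e else if adj e d then 1 else 0))"
proof -
  define A :: "nat \<Rightarrow> nat \<Rightarrow> bit" where "A e d = (if e = d then fr e else if adj e d then 1 else 0)" for e d
  have "det (adj_matrix adj fr U) \<noteq> 0 \<longleftrightarrow> U \<in> snd (lag_dm V (graph_lag V A))" if U: "U \<subseteq> V" for U
    unfolding det_adj_matrix[OF finite_subset[OF U fin]] A_def[symmetric]
  proof
    assume nd: "\<forall>x. (\<forall>e\<in>U. (\<Sum>d\<in>U. A e d * x d) = 0) \<longrightarrow> (\<forall>e\<in>U. x e = 0)"
    show "U \<in> snd (lag_dm V (graph_lag V A))"
      unfolding mem_lag_dm
    proof (intro conjI ballI impI allI)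
      fix v e b assume v: "v \<in> graph_lag V A" "\<forall>e\<in>V. v (e, e \<notin> U) = 0" and e: "e \<in> V"
      have "(\<Sum>d\<in>U. A e d * v (d, True)) = 0" if "e \<in> U" for e
      proof -
        have "(\<Sum>d\<in>U. A e d * v (d, True)) = (\<Sum>d\<in>V. A e d * v (d, True))"
          using v(2) U fin by (intro sum.mono_neutral_left) force+
        also have "\<dots> = v (e, False)" using v(1) U that by (auto simp: graph_lag_def)
        also have "\<dots> = 0" using v(2) U that by force
        finally show ?thesis .
      qed
      then have "\<forall>e\<in>U. v (e, True) = 0" using nd[rule_format, of "\<lambda>d. v (d, True)"] by blast
      then have T: "v (e, True) = 0" if "e \<in> V" for e using v(2) that by (cases "e \<in> U") force+
      then show "v (e, b) = 0" using v(1) e by (cases b) (auto simp: graph_lag_def)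
    qed (use U in auto)
  next
    assume nd: "U \<in> snd (lag_dm V (graph_lag V A))"
    show "\<forall>x. (\<forall>e\<in>U. (\<Sum>d\<in>U. A e d * x d) = 0) \<longrightarrow> (\<forall>e\<in>U. x e = 0)"
    proof (intro allI impI ballI)
      fix x e assume x: "\<forall>e\<in>U. (\<Sum>d\<in>U. A e d * x d) = 0" and e: "e \<in> U"
      \<comment> \<open>The point of the graph over the extension of \<open>x\<close> by
        zero.\<close>
      define v :: vct where
        "v = (\<lambda>(d, b). if b then if d \<in> U then x d else 0 else (\<Sum>c\<in>U. A d c * x c))"
      have "(\<Sum>c\<in>V. A d c * v (c, True)) = (\<Sum>c\<in>U. A d c * x c)" for d
        unfolding v_def using U fin by (intro sum.mono_neutral_cong_right) auto
      then have "v \<in> graph_lag V A" by (simp add: graph_lag_def v_def)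
      moreover have "\<forall>d\<in>V. v (d, d \<notin> U) = 0" using x by (auto simp: v_def)
      ultimately have "v (e, True) = 0" using nd e U unfolding mem_lag_dm by blast
      then show "x e = 0" using e by (simp add: v_def)
    qed
  qed
  then show ?thesis unfolding nondeg_dm_def A_def[symmetric]
    by (intro prod_eqI) (auto simp: mem_lag_dm)
qed

section \<open>Transport of set systems and Lagrangians along injective relabelings\<close>

definition ss_image :: "(nat \<Rightarrow> nat) \<Rightarrow> ssys \<Rightarrow> ssys" where
  "ss_image f D = (f ` fst D, (\<lambda>\<phi>. f ` \<phi>) ` snd D)"

lemma ss_iso_iff_image: "ss_iso D D' \<longleftrightarrow> (\<exists>f. inj_on f (fst D) \<and> D' = ss_image f D)"
  unfolding ss_iso_def ss_image_def bij_betw_def by (cases D') auto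

lemma fst_ss_image [simp]: "fst (ss_image f D) = f ` fst D"
  by (simp add: ss_image_def)

text \<open>Defined by pulling vectors back along \<open>f\<close>, not by pushing them forward:
  this leaves the coordinates outside the image of the ground set free, as the convention on
  Lagrangians requires.\<close>

definition lag_image :: "(nat \<Rightarrow> nat) \<Rightarrow> vct set \<Rightarrow> vct set" where
  "lag_image f L = {w. (\<lambda>(e, b). w (f e, b)) \<in> L}"

lemma pairing_image:
  assumes "inj_on f E"
  shows "pairing (f ` E) v w = pairing E (\<lambda>(e, b). v (f e, b)) (\<lambda>(e, b). w (f e, b))"
  unfolding pairing_def using assms by (simp add: sum.reindex)

text \<open>A partial inverse to the pullback in \<open>lag_image\<close>: it turns a vector of
  \<open>L\<close> into a test vector over the image of \<open>E\<close>.\<close>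

lemma lift_vct_image:
  assumes "inj_on f E" "lagrangian E L" "v \<in> L"
  obtains w where "w \<in> lag_image f L" "\<And>e b. e \<in> E \<Longrightarrow> w (f e, b) = v (e, b)"
proof
  let ?w = "\<lambda>(e, b). v (inv_into E f e, b)"
  show eq: "?w (f e, b) = v (e, b)" if "e \<in> E" for e b using assms(1) that by simp
  show "?w \<in> lag_image f L" unfolding lag_image_def mem_Collect_eq
    by (rule lagrangian_cong[OF assms(2,3)]) (use assms(1) in simp)
qed

lemma lagrangian_image:
  assumes f: "inj_on f E" and L: "lagrangian E L"
  shows "lagrangian (f ` E) (lag_image f L)"
proof (rule lagrangianI)
  fix v w assume "v \<in> lag_image f L" "w \<in> lag_image f L"
  then show "pairing (f ` E) v w = 0"
    unfolding pairing_image[OF f] by (intro lagrangian_isotropic[OF L]) (simp_all add: lag_image_def)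
next
  fix v assume v: "\<And>w. w \<in> lag_image f L \<Longrightarrow> pairing (f ` E) v w = 0"
  have "pairing E (\<lambda>(e, b). v (f e, b)) w = 0" if "w \<in> L" for w
  proof -
    obtain w' where w': "w' \<in> lag_image f L" "\<And>e b. e \<in> E \<Longrightarrow> w' (f e, b) = w (e, b)"
      by (rule lift_vct_image[OF f L \<open>w \<in> L\<close>]) blast
    from v[OF w'(1)] show ?thesis unfolding pairing_image[OF f]
      using w'(2) pairing_cong[of E "\<lambda>(e, b). v (f e, b)" "\<lambda>(e, b). v (f e, b)" "\<lambda>(e, b). w' (f e, b)" w]
      by simp
  qed
  then show "v \<in> lag_image f L" unfolding lag_image_def mem_Collect_eq
    by (intro iffD2[OF lagrangian_mem[OF L]] ballI)
qed

lemma lag_dm_image: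
  assumes f: "inj_on f E" and L: "lagrangian E L"
  shows "lag_dm (f ` E) (lag_image f L) = ss_image f (lag_dm E L)"
proof (intro prod_eqI)
  have key: "f ` U \<in> snd (lag_dm (f ` E) (lag_image f L)) \<longleftrightarrow> U \<in> snd (lag_dm E L)" if U: "U \<subseteq> E" for U
  proof -
    have nin: "f e \<notin> f ` U \<longleftrightarrow> e \<notin> U" if "e \<in> E" for e
      using inj_on_image_mem_iff[OF f that U] by simp
    show ?thesis
    proof
      assume F: "f ` U \<in> snd (lag_dm (f ` E) (lag_image f L))"
      show "U \<in> snd (lag_dm E L)" unfolding mem_lag_dm
      proof (intro conjI ballI impI allI)
        fix v e b assume v: "v \<in> L" "\<forall>e\<in>E. v (e, e \<notin> U) = 0" and e: "e \<in> E"
        obtain w where w: "w \<in> lag_image f L" "\<And>e b. e \<in> E \<Longrightarrow> w (f e, b) = v (e, b)"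
          by (rule lift_vct_image[OF f L v(1)]) blast
        then have "\<forall>e\<in>f ` E. w (e, e \<notin> f ` U) = 0" using v(2) nin by simp
        then have "w (f e, b) = 0" using F w(1) e unfolding mem_lag_dm by blast
        then show "v (e, b) = 0" using w(2)[OF e] by simp
      qed (use U in auto)
    next
      assume F: "U \<in> snd (lag_dm E L)"
      show "f ` U \<in> snd (lag_dm (f ` E) (lag_image f L))" unfolding mem_lag_dm
      proof (intro conjI ballI impI allI)
        fix w e' b assume w: "w \<in> lag_image f L" "\<forall>e\<in>f ` E. w (e, e \<notin> f ` U) = 0" and e': "e' \<in> f ` E"
        then obtain e where e: "e \<in> E" "e' = f e" by blast
        have "(\<lambda>(e, b). w (f e, b)) \<in> L" using w(1) by (simp add: lag_image_def)
        moreover have "\<forall>e\<in>E. (\<lambda>(e, b). w (f e, b)) (e, e \<notin> U) = 0" using w(2) nin by simp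
        ultimately have "(\<lambda>(e, b). w (f e, b)) (e, b) = 0" using F e unfolding mem_lag_dm by blast
        then show "w (e', b) = 0" using e by simp
      qed (use U in auto)
    qed
  qed
  show "snd (lag_dm (f ` E) (lag_image f L)) = snd (ss_image f (lag_dm E L))"
  proof (intro Set.set_eqI iffI)
    fix W assume W: "W \<in> snd (lag_dm (f ` E) (lag_image f L))"
    then have "W \<subseteq> f ` E" by (simp add: mem_lag_dm)
    then obtain U where "U \<subseteq> E" "W = f ` U" by (metis subset_imageE)
    then show "W \<in> snd (ss_image f (lag_dm E L))" using W key by (auto simp: ss_image_def)
  next
    fix W assume "W \<in> snd (ss_image f (lag_dm E L))"
    then obtain U where U: "U \<in> snd (lag_dm E L)" "W = f ` U" by (auto simp: ss_image_def)
    then have "U \<subseteq> E" by (simp add: mem_lag_dm)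
    then show "W \<in> snd (lag_dm (f ` E) (lag_image f L))" using U key by blast
  qed
qed simp

lemma set_system_lag_dm:
  assumes "finite E" "snd (lag_dm E L) \<noteq> {}"
  shows "set_system (lag_dm E L)"
  using assms by (auto simp: set_system_def mem_lag_dm)

lemma binary_dm_lagrangian:
  assumes "binary_dm D"
  obtains L where "lagrangian (fst D) L" "D = lag_dm (fst D) L"
proof -
  obtain V adj fr T where G: "framed_graph V adj" "T \<subseteq> V"
    and iso: "ss_iso (twist (nondeg_dm V adj fr) T) D"
    using assms unfolding binary_dm_def by blast
  define A :: "nat \<Rightarrow> nat \<Rightarrow> bit" where "A = (\<lambda>e d. if e = d then fr e else if adj e d then 1 else 0)"
  have fin: "finite V" and sym: "A e d = A d e" for e d
    using G(1) by (auto simp: framed_graph_def A_def)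
  define L where "L = lag_twist T (graph_lag V A)"
  have L: "lagrangian V L" unfolding L_def
    by (intro lagrangian_twist lagrangian_graph fin sym)
  have "twist (nondeg_dm V adj fr) T = lag_dm V L"
    using nondeg_dm_eq_lag_dm[OF fin] lag_dm_twist[OF G(2)] by (simp add: L_def A_def)
  with iso obtain f where f: "inj_on f V" "D = ss_image f (lag_dm V L)"
    unfolding ss_iso_iff_image by auto
  have E: "fst D = f ` V" using f by simp
  show ?thesis
  proof (rule that)
    show "lagrangian (fst D) (lag_image f L)" unfolding E by (rule lagrangian_image[OF f(1) L])
    show "D = lag_dm (fst D) (lag_image f L)" unfolding E lag_dm_image[OF f(1) L] by (rule f(2))
  qed
qed

lemma binary_dm_lag_dm:
  assumes fin: "finite E" and L: "lagrangian E L" and ne: "snd (lag_dm E L) \<noteq> {}"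
  shows "binary_dm (lag_dm E L)"
proof -
  obtain U where U: "U \<in> snd (lag_dm E L)" using ne by blast
  then have UE: "U \<subseteq> E" by (simp add: mem_lag_dm)
  have "{} \<in> snd (lag_dm E (lag_twist U L))"
    unfolding lag_dm_twist[OF UE] mem_twist using U by simp
  then obtain A where A: "\<And>e d. e \<in> E \<Longrightarrow> d \<in> E \<Longrightarrow> A e d = A d e" "lag_twist U L = graph_lag E A"
    using lagrangian_is_graph[OF fin lagrangian_twist[OF L]] by blast
  \<comment> \<open>Over the field with two elements a symmetric matrix is the same as a framed
    graph: the diagonal is the framing and the nonzero off-diagonal entries are the edges.\<close>
  define adj where "adj d e \<longleftrightarrow> d \<in> E \<and> e \<in> E \<and> d \<noteq> e \<and> A d e = 1" for d e
  define fr where "fr e = A e e" for e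
  have "graph_lag E A = graph_lag E (\<lambda>e d. if e = d then fr e else if adj e d then 1 else 0)"
    unfolding graph_lag_def adj_def fr_def
    by (intro Collect_cong ball_cong refl arg_cong2[where f = "(=)"] sum.cong) auto
  then have "lag_dm E (lag_twist U L) = nondeg_dm E adj fr"
    using A(2) nondeg_dm_eq_lag_dm[OF fin, of adj fr] by simp
  then have "twist (nondeg_dm E adj fr) U = lag_dm E L"
    using lag_dm_twist[OF UE, of "lag_twist U L"] by (simp add: lag_twist_twice)
  moreover have "ss_iso (lag_dm E L) (lag_dm E L)"
    unfolding ss_iso_iff_image by (intro exI[of _ "\<lambda>x. x"]) (auto simp: ss_image_def lag_dm_def)
  moreover have "framed_graph E adj"
    using fin A(1) by (auto simp: framed_graph_def adj_def)
  ultimately show ?thesis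
    unfolding binary_dm_def using UE set_system_lag_dm[OF fin ne] by metis
qed

section \<open>Direct sums as intersections of Lagrangians\<close>

text \<open>A vector of one summand, cut off to zero outside its own ground set, lies in both
  Lagrangians. Such vectors separate orthogonality to the intersection into orthogonality to each
  summand.\<close>

lemma lagrangian_Int:
  assumes fin: "finite E1" "finite E2" and disj: "E1 \<inter> E2 = {}"
    and L: "lagrangian E1 L1" "lagrangian E2 L2"
  shows "lagrangian (E1 \<union> E2) (L1 \<inter> L2)"
proof (rule lagrangianI)
  have un: "pairing (E1 \<union> E2) v w = pairing E1 v w + pairing E2 v w" for v w
    unfolding pairing_def by (rule sum.union_disjoint[OF fin disj])
  fix v
  show "pairing (E1 \<union> E2) v w = 0" if "v \<in> L1 \<inter> L2" "w \<in> L1 \<inter> L2" for w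
    using that lagrangian_isotropic[OF L(1), of v w] lagrangian_isotropic[OF L(2), of v w] by (simp add: un)
  assume v: "\<And>w. w \<in> L1 \<inter> L2 \<Longrightarrow> pairing (E1 \<union> E2) v w = 0"
  have "pairing E1 v w = 0" if w: "w \<in> L1" for w
  proof -
    let ?w = "\<lambda>(e, b). if e \<in> E1 then w (e, b) else 0"
    have "?w \<in> L1" using lagrangian_cong[OF L(1) w, of ?w] by simp
    moreover have z: "?w (e, b) = 0" if "e \<in> E2" for e b using disj that by auto
    ultimately have "pairing (E1 \<union> E2) v ?w = 0" using lagrangian_zero[OF L(2), of ?w] v by blast
    moreover have "pairing E2 v ?w = 0" using pairing_zero[of E2 ?w v] z by (simp add: pairing_commute)
    moreover have "pairing E1 v ?w = pairing E1 v w" by (rule pairing_cong) auto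
    ultimately show ?thesis using un[of v ?w] by simp
  qed
  moreover have "pairing E2 v w = 0" if w: "w \<in> L2" for w
  proof -
    let ?w = "\<lambda>(e, b). if e \<in> E2 then w (e, b) else 0"
    have "?w \<in> L2" using lagrangian_cong[OF L(2) w, of ?w] by simp
    moreover have z: "?w (e, b) = 0" if "e \<in> E1" for e b using disj that by auto
    ultimately have "pairing (E1 \<union> E2) v ?w = 0" using lagrangian_zero[OF L(1), of ?w] v by blast
    moreover have "pairing E1 v ?w = 0" using pairing_zero[of E1 ?w v] z by (simp add: pairing_commute)
    moreover have "pairing E2 v ?w = pairing E2 v w" by (rule pairing_cong) auto
    ultimately show ?thesis using un[of v ?w] by simp
  qed
  ultimately show "v \<in> L1 \<inter> L2" using lagrangian_mem[OF L(1)] lagrangian_mem[OF L(2)] by blast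
qed

lemma lag_dm_Int:
  assumes disj: "E1 \<inter> E2 = {}" and L: "lagrangian E1 L1" "lagrangian E2 L2"
  shows "lag_dm (E1 \<union> E2) (L1 \<inter> L2) = dsum (lag_dm E1 L1) (lag_dm E2 L2)"
proof (intro prod_eqI)
  show "fst (lag_dm (E1 \<union> E2) (L1 \<inter> L2)) = fst (dsum (lag_dm E1 L1) (lag_dm E2 L2))"
    by (simp add: dsum_def)
  have key: "U1 \<union> U2 \<in> snd (lag_dm (E1 \<union> E2) (L1 \<inter> L2)) \<longleftrightarrow>
      U1 \<in> snd (lag_dm E1 L1) \<and> U2 \<in> snd (lag_dm E2 L2)" if U: "U1 \<subseteq> E1" "U2 \<subseteq> E2" for U1 U2
  proof -
    have nin: "e \<in> E1 \<Longrightarrow> e \<notin> U1 \<union> U2 \<longleftrightarrow> e \<notin> U1" "e \<in> E2 \<Longrightarrow> e \<notin> U1 \<union> U2 \<longleftrightarrow> e \<notin> U2" for e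
      using U disj by auto
    show ?thesis
    proof (intro iffI conjI)
      assume F: "U1 \<union> U2 \<in> snd (lag_dm (E1 \<union> E2) (L1 \<inter> L2))"
      show "U1 \<in> snd (lag_dm E1 L1)" unfolding mem_lag_dm
      proof (intro conjI ballI impI allI)
        fix v e b assume v: "v \<in> L1" "\<forall>e\<in>E1. v (e, e \<notin> U1) = 0" and e: "e \<in> E1"
        let ?v = "\<lambda>(e, b). if e \<in> E1 then v (e, b) else 0"
        have "?v \<in> L1" using lagrangian_cong[OF L(1) v(1), of ?v] by simp
        moreover have z: "?v (e, b) = 0" if "e \<in> E2" for e b using disj that by auto
        then have "?v \<in> L2" using lagrangian_zero[OF L(2), of ?v] by blast
        moreover have "\<forall>e\<in>E1 \<union> E2. ?v (e, e \<notin> U1 \<union> U2) = 0" using v(2) nin z by auto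
        ultimately have "?v (e, b) = 0" using F e unfolding mem_lag_dm by blast
        then show "v (e, b) = 0" using e by simp
      qed (use U in auto)
      show "U2 \<in> snd (lag_dm E2 L2)" unfolding mem_lag_dm
      proof (intro conjI ballI impI allI)
        fix v e b assume v: "v \<in> L2" "\<forall>e\<in>E2. v (e, e \<notin> U2) = 0" and e: "e \<in> E2"
        let ?v = "\<lambda>(e, b). if e \<in> E2 then v (e, b) else 0"
        have "?v \<in> L2" using lagrangian_cong[OF L(2) v(1), of ?v] by simp
        moreover have z: "?v (e, b) = 0" if "e \<in> E1" for e b using disj that by auto
        then have "?v \<in> L1" using lagrangian_zero[OF L(1), of ?v] by blast
        moreover have "\<forall>e\<in>E1 \<union> E2. ?v (e, e \<notin> U1 \<union> U2) = 0" using v(2) nin z by auto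
        ultimately have "?v (e, b) = 0" using F e unfolding mem_lag_dm by blast
        then show "v (e, b) = 0" using e by simp
      qed (use U in auto)
    next
      assume F: "U1 \<in> snd (lag_dm E1 L1) \<and> U2 \<in> snd (lag_dm E2 L2)"
      show "U1 \<union> U2 \<in> snd (lag_dm (E1 \<union> E2) (L1 \<inter> L2))" unfolding mem_lag_dm
      proof (intro conjI ballI impI allI)
        fix v e b assume v: "v \<in> L1 \<inter> L2" "\<forall>e\<in>E1 \<union> E2. v (e, e \<notin> U1 \<union> U2) = 0"
          and e: "e \<in> E1 \<union> E2"
        have "\<forall>e\<in>E1. v (e, e \<notin> U1) = 0"
        proof
          fix e assume "e \<in> E1"
          then show "v (e, e \<notin> U1) = 0" using v(2)[rule_format, of e] nin(1) by simp
        qed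
        moreover have "\<forall>e\<in>E2. v (e, e \<notin> U2) = 0"
        proof
          fix e assume "e \<in> E2"
          then show "v (e, e \<notin> U2) = 0" using v(2)[rule_format, of e] nin(2) by simp
        qed
        ultimately show "v (e, b) = 0" using F v(1) e unfolding mem_lag_dm by blast
      qed (use U in auto)
    qed
  qed
  show "snd (lag_dm (E1 \<union> E2) (L1 \<inter> L2)) = snd (dsum (lag_dm E1 L1) (lag_dm E2 L2))"
  proof (intro Set.set_eqI iffI)
    fix W assume W: "W \<in> snd (lag_dm (E1 \<union> E2) (L1 \<inter> L2))"
    then have "W = (W \<inter> E1) \<union> (W \<inter> E2)" by (auto simp: mem_lag_dm)
    then show "W \<in> snd (dsum (lag_dm E1 L1) (lag_dm E2 L2))"
      using W key[of "W \<inter> E1" "W \<inter> E2"] by (auto simp: dsum_def)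
  next
    fix W assume "W \<in> snd (dsum (lag_dm E1 L1) (lag_dm E2 L2))"
    then obtain U1 U2 where U: "W = U1 \<union> U2" "U1 \<in> snd (lag_dm E1 L1)" "U2 \<in> snd (lag_dm E2 L2)"
      by (auto simp: dsum_def)
    then have "U1 \<subseteq> E1" "U2 \<subseteq> E2" by (auto simp: mem_lag_dm)
    then show "W \<in> snd (lag_dm (E1 \<union> E2) (L1 \<inter> L2))" using key U by simp
  qed
qed

subsection \<open>Deletion and restriction\<close>

text \<open>Symplectic reduction by the span of the unit vectors at \<open>(e, False)\<close> for
  \<open>e\<close> in \<open>E - A\<close>: the condition \<open>v (e, True) = 0\<close> describes
  its orthogonal complement, and passing to the quotient forgets the coordinates outside
  \<open>A\<close>. Stating it for a whole set \<open>A\<close> leaves no order of deletion in the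
  formula.\<close>

definition lag_restr :: "nat set \<Rightarrow> nat set \<Rightarrow> vct set \<Rightarrow> vct set" where
  "lag_restr E A L = {w. \<exists>v\<in>L. (\<forall>e\<in>E - A. v (e, True) = 0) \<and> (\<forall>e\<in>A. \<forall>b. w (e, b) = v (e, b))}"

lemma lagrangian_delete:
  assumes fin: "finite E" and e: "e \<in> E" and L: "lagrangian E L"
  shows "lagrangian (E - {e}) (lag_restr E (E - {e}) L)"
proof (rule lagrangianI)
  have E: "E - (E - {e}) = {e}" using e by blast
  fix v
  show "pairing (E - {e}) v w = 0" if v: "v \<in> lag_restr E (E - {e}) L" and w: "w \<in> lag_restr E (E - {e}) L" for w
  proof -
    obtain v' where v': "v' \<in> L" "v' (e, True) = 0" "\<forall>d\<in>E - {e}. \<forall>b. v (d, b) = v' (d, b)"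
      using v unfolding lag_restr_def E by blast
    obtain w' where w': "w' \<in> L" "w' (e, True) = 0" "\<forall>d\<in>E - {e}. \<forall>b. w (d, b) = w' (d, b)"
      using w unfolding lag_restr_def E by blast
    have "pairing (E - {e}) v w = pairing (E - {e}) v' w'" using v' w' by (intro pairing_cong) auto
    also have "\<dots> = pairing E v' w'" using v' w' by (simp add: pairing_insert[OF fin e, of v' w'])
    also have "\<dots> = 0" using L v' w' by (intro lagrangian_isotropic)
    finally show ?thesis .
  qed
  assume perp: "\<And>w. w \<in> lag_restr E (E - {e}) L \<Longrightarrow> pairing (E - {e}) v w = 0"
  \<comment> \<open>A lift of \<open>v\<close> to \<open>E\<close> must vanish at
    \<open>(e, True)\<close>; only its value \<open>c\<close> at \<open>(e, False)\<close> is open.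
    Vectors of \<open>L\<close> with \<open>u (e, True) = 0\<close> put no condition on
    \<open>c\<close>, and any two of the others differ by such a vector, so all of them prescribe
    the same \<open>c\<close>.\<close>
  define v1 where "v1 c = v((e, True) := 0, (e, False) := c)" for c
  have v1: "pairing E (v1 c) u = c * u (e, True) + pairing (E - {e}) v u" for c u
  proof -
    have "pairing (E - {e}) (v1 c) u = pairing (E - {e}) v u" by (intro pairing_cong) (auto simp: v1_def)
    then show ?thesis unfolding pairing_insert[OF fin e] by (simp add: v1_def)
  qed
  have orth: "pairing (E - {e}) v u = 0" if "u \<in> L" "u (e, True) = 0" for u
    using that by (intro perp) (auto simp: lag_restr_def E)
  have "\<exists>c. \<forall>u\<in>L. pairing E (v1 c) u = 0"
  proof (cases "\<exists>l\<in>L. l (e, True) = 1")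
    case True
    then obtain l where l: "l \<in> L" "l (e, True) = 1" by blast
    have "pairing E (v1 (pairing (E - {e}) v l)) u = 0" if u: "u \<in> L" for u
    proof (cases "u (e, True) = 0")
      case True
      then show ?thesis using orth[OF u] by (simp add: v1)
    next
      case False
      have "(\<lambda>p. u p + l p) \<in> L" by (rule lagrangian_add[OF L u l(1)])
      then have "pairing (E - {e}) v (\<lambda>p. u p + l p) = 0" using orth False l by simp
      then have "pairing (E - {e}) v l = pairing (E - {e}) v u"
        using pairing_add_left[of "E - {e}" u l v] by (simp add: pairing_commute bit_add_eq_0_iff)
      then show ?thesis using False by (simp add: v1)
    qed
    then show ?thesis by blast
  next
    case False
    then have "\<forall>u\<in>L. pairing E (v1 0) u = 0" using orth by (simp add: v1)
    then show ?thesis by blast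
  qed
  then obtain c where c: "\<forall>u\<in>L. pairing E (v1 c) u = 0" by blast
  have "v1 c \<in> L" by (rule iffD2[OF lagrangian_mem[OF L] c])
  then show "v \<in> lag_restr E (E - {e}) L"
    unfolding lag_restr_def E by (auto simp: v1_def intro!: bexI[of _ "v1 c"])
qed

text \<open>If U is feasible but U - {e} is not, the failure is witnessed by a vector v of L in the
  coordinate space of U - {e}; isotropy against v makes the symmetric difference of U with {e, f}
  feasible for any other f in the support of v.\<close>

lemma exists_feasible_avoiding:
  assumes fin: "finite E" and e: "e \<in> E" and L: "lagrangian E L"
    and nodelta: "(\<lambda>p. if p = (e, False) then 1 else 0) \<notin> L"
    and ne: "snd (lag_dm E L) \<noteq> {}"
  shows "\<exists>U\<in>snd (lag_dm E L). e \<notin> U"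
proof (rule ccontr)
  assume "\<not> ?thesis"
  then have all: "\<And>U. U \<in> snd (lag_dm E L) \<Longrightarrow> e \<in> U" by blast
  obtain U where U: "U \<in> snd (lag_dm E L)" using ne by blast
  have eU: "e \<in> U" and UE: "U \<subseteq> E" using U all by (auto simp: mem_lag_dm)
  have feas: "v (d, b) = 0" if "v \<in> L" "\<And>d. d \<in> E \<Longrightarrow> v (d, d \<notin> U) = 0" "d \<in> E" for v d b
    using U that unfolding mem_lag_dm by blast
  have "U - {e} \<notin> snd (lag_dm E L)" using all by blast
  then obtain v d0 b0 where v: "v \<in> L" and v0: "\<And>d. d \<in> E \<Longrightarrow> v (d, d \<notin> U - {e}) = 0"
    and d0: "d0 \<in> E" "v (d0, b0) \<noteq> 0"
    using UE unfolding mem_lag_dm by blast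
  have veT: "v (e, True) = 0" using v0[OF e] by simp
  have vU: "v (d, d \<notin> U) = 0" if "d \<in> E" "d \<noteq> e" for d using v0[OF that(1)] that(2) by simp
  have veF: "v (e, False) \<noteq> 0"
  proof
    assume "v (e, False) = 0"
    then have "v (d, d \<notin> U) = 0" if "d \<in> E" for d using vU[OF that] eU by (cases "d = e") auto
    then show False using feas[OF v] d0 by blast
  qed
  have "\<exists>f\<in>E - {e}. \<exists>b. v (f, b) \<noteq> 0"
  proof (rule ccontr)
    assume "\<not> ?thesis"
    then have z: "\<And>d b. d \<in> E \<Longrightarrow> d \<noteq> e \<Longrightarrow> v (d, b) = 0" by blast
    have "(if (d, b) = (e, False) then 1 else 0) = v (d, b)" if "d \<in> E" for d b
      using that z veT veF by (cases "d = e"; cases b) auto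
    then have "(\<lambda>p. if p = (e, False) then 1 else 0) \<in> L" by (rule lagrangian_cong[OF L v])
    then show False using nodelta by blast
  qed
  then obtain f b where f: "f \<in> E" "f \<noteq> e" "v (f, b) \<noteq> 0" by blast
  then have b: "b = (f \<in> U)" using vU[of f] by (cases "f \<in> U"; cases b) auto
  define W where "W = (if f \<in> U then U - {e, f} else insert f (U - {e}))"
  have W: "d \<notin> W \<longleftrightarrow> (if d = e then True else if d = f then f \<in> U else d \<notin> U)" for d
    using f eU by (auto simp: W_def)
  have "W \<in> snd (lag_dm E L)" unfolding mem_lag_dm
  proof (intro conjI ballI impI allI)
    show "W \<subseteq> E" using UE f by (auto simp: W_def)
    fix w d b' assume w: "w \<in> L" "\<forall>d\<in>E. w (d, d \<notin> W) = 0" and d: "d \<in> E"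
    have weT: "w (e, True) = 0" using w(2)[rule_format, OF e] by (simp add: W)
    have wf: "w (f, f \<in> U) = 0" using w(2)[rule_format, OF f(1)] f(2) by (simp add: W)
    have wU: "w (d, d \<notin> U) = 0" if "d \<in> E" "d \<noteq> e" "d \<noteq> f" for d
      using w(2)[rule_format, OF that(1)] that by (simp add: W)
    \<comment> \<open>At elements other than \<open>e\<close> and \<open>f\<close> both vectors
      vanish in the same coordinate, and at \<open>e\<close> both \<open>True\<close> coordinates
      vanish. Isotropy therefore leaves a single product at \<open>f\<close>, whose factor from
      \<open>v\<close> is nonzero.\<close>
    have "pairing (E - {f}) w v = 0" unfolding pairing_def
    proof (rule sum.neutral, rule ballI)
      fix d assume d: "d \<in> E - {f}"
      show "w (d, True) * v (d, False) + w (d, False) * v (d, True) = 0"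
      proof (cases "d = e")
        case True
        then show ?thesis using weT veT by simp
      next
        case False
        then show ?thesis using wU[of d] vU[of d] d by (cases "d \<in> U") auto
      qed
    qed
    then have "w (f, True) * v (f, False) + w (f, False) * v (f, True) = 0"
      using lagrangian_isotropic[OF L w(1) v] pairing_insert[OF fin f(1), of w v] by simp
    then have wf': "w (f, b') = 0" for b'
      using f(1-3) wf vU[of f] unfolding b by (cases b'; cases "f \<in> U") auto
    have weF: "w (e, False) = 0"
    proof (rule ccontr)
      assume weF: "w (e, False) \<noteq> 0"
      \<comment> \<open>The two \<open>False\<close> coordinates at \<open>e\<close> are both 1 and
        cancel, so the sum lies in the coordinate Lagrangian of \<open>U\<close>. Feasibility of
        \<open>U\<close> would make it zero, but at \<open>f\<close> it equals the nonzero value of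
        \<open>v\<close>.\<close>
      have "(\<lambda>p. w p + v p) \<in> L" by (rule lagrangian_add[OF L w(1) v])
      then have "w (f, b) + v (f, b) = 0"
      proof (rule feas[where v = "\<lambda>p. w p + v p"])
        fix d assume "d \<in> E"
        then show "w (d, d \<notin> U) + v (d, d \<notin> U) = 0"
          using weF veF eU wf' wU[of d] vU[of d] by (cases "d = e"; cases "d = f") auto
      qed (rule f(1))
      then show False using wf' f(3) by simp
    qed
    show "w (d, b') = 0"
    proof (rule feas[OF w(1) _ d])
      fix d assume "d \<in> E"
      then show "w (d, d \<notin> U) = 0" using weF eU wf' wU[of d] by (cases "d = e"; cases "d = f") auto
    qed
  qed
  then show False using all[of W] W[of e] by simp
qed

lemma lag_dm_feasibleD:
  assumes "U \<in> snd (lag_dm E L)" "v \<in> L" "\<And>d. d \<in> E \<Longrightarrow> v (d, d \<notin> U) = 0" "e \<in> E"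
  shows "v (e, b) = 0"
  using assms unfolding mem_lag_dm by blast

text \<open>The case distinction in \<open>del\<close> matches whether the unit vector at
  \<open>(e, False)\<close> belongs to \<open>L\<close>: membership makes \<open>e\<close> a coloop,
  and \<open>exists_feasible_avoiding\<close> handles the opposite case.\<close>

lemma del_lag_dm:
  assumes fin: "finite E" and e: "e \<in> E" and L: "lagrangian E L"
    and ne: "snd (lag_dm E L) \<noteq> {}"
  shows "del e (lag_dm E L) = lag_dm (E - {e}) (lag_restr E (E - {e}) L)"
proof -
  let ?\<delta> = "\<lambda>p. if p = (e, False) then 1 else 0 :: bit"
  have E: "E - (E - {e}) = {e}" using e by blast
  have restr: "U \<in> snd (lag_dm (E - {e}) (lag_restr E (E - {e}) L)) \<longleftrightarrow> U \<subseteq> E - {e} \<and>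
      (\<forall>v\<in>L. v (e, True) = 0 \<longrightarrow> (\<forall>d\<in>E - {e}. v (d, d \<notin> U) = 0) \<longrightarrow> (\<forall>d\<in>E - {e}. \<forall>b. v (d, b) = 0))"
    (is "_ \<longleftrightarrow> ?R U") for U
  proof
    assume F: "U \<in> snd (lag_dm (E - {e}) (lag_restr E (E - {e}) L))"
    have "v (d, b) = 0" if "v \<in> L" "v (e, True) = 0" "\<forall>d\<in>E - {e}. v (d, d \<notin> U) = 0" "d \<in> E - {e}" for v d b
    proof -
      have "v \<in> lag_restr E (E - {e}) L" using that(1,2) unfolding lag_restr_def E by blast
      then show ?thesis using F that(3,4) unfolding mem_lag_dm by blast
    qed
    then show "?R U" using F unfolding mem_lag_dm by blast
  next
    assume F: "?R U"
    show "U \<in> snd (lag_dm (E - {e}) (lag_restr E (E - {e}) L))" unfolding mem_lag_dm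
    proof (intro conjI ballI impI allI)
      fix w d b assume w: "w \<in> lag_restr E (E - {e}) L" "\<forall>d\<in>E - {e}. w (d, d \<notin> U) = 0" and d: "d \<in> E - {e}"
      obtain v where v: "v \<in> L" "v (e, True) = 0" "\<forall>d\<in>E - {e}. \<forall>b. w (d, b) = v (d, b)"
        using w(1) unfolding lag_restr_def E by blast
      have "\<forall>d\<in>E - {e}. v (d, d \<notin> U) = 0" using w(2) v(3) by metis
      then have "v (d, b) = 0" using F v(1,2) d by blast
      then show "w (d, b) = 0" using v(3) d by simp
    qed (use F in blast)
  qed
  show ?thesis
  proof (cases "?\<delta> \<in> L")
    case True
    \<comment> \<open>Pairing with the unit vector at \<open>(e, False)\<close> reads off the
      coordinate \<open>(e, True)\<close>.\<close>
    have T0: "v (e, True) = 0" if "v \<in> L" for v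
    proof -
      have "pairing E v ?\<delta> = v (e, True) + pairing (E - {e}) v ?\<delta>"
        by (simp add: pairing_insert[OF fin e])
      moreover have "pairing (E - {e}) v ?\<delta> = 0"
        by (subst pairing_commute) (rule pairing_zero, auto)
      ultimately show ?thesis using lagrangian_isotropic[OF L that True] by simp
    qed
    have coloop: "e \<in> U" if "U \<in> snd (lag_dm E L)" for U
    proof (rule ccontr)
      assume "e \<notin> U"
      then have "\<And>d. d \<in> E \<Longrightarrow> ?\<delta> (d, d \<notin> U) = 0" by auto
      from lag_dm_feasibleD[OF that True this e] have "?\<delta> (e, False) = 0" by blast
      then show False by simp
    qed
    have "U \<in> snd (lag_dm (E - {e}) (lag_restr E (E - {e}) L)) \<longleftrightarrow> insert e U \<in> snd (lag_dm E L)"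
      if U: "U \<subseteq> E - {e}" for U
    proof
      assume F: "U \<in> snd (lag_dm (E - {e}) (lag_restr E (E - {e}) L))"
      show "insert e U \<in> snd (lag_dm E L)" unfolding mem_lag_dm
      proof (intro conjI ballI impI allI)
        fix v d b assume v: "v \<in> L" "\<forall>d\<in>E. v (d, d \<notin> insert e U) = 0" and d: "d \<in> E"
        have "v (e, False) = 0" using v(2)[rule_format, OF e] by simp
        moreover have "\<forall>d\<in>E - {e}. v (d, d \<notin> U) = 0"
        proof
          fix d assume "d \<in> E - {e}"
          then show "v (d, d \<notin> U) = 0" using v(2)[rule_format, of d] by simp
        qed
        then have "\<forall>d\<in>E - {e}. \<forall>b. v (d, b) = 0" using F v(1) T0[OF v(1)] unfolding restr by blast
        ultimately show "v (d, b) = 0" using d T0[OF v(1)] by (cases "d = e"; cases b) simp_all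
      qed (use U e in auto)
    next
      assume F: "insert e U \<in> snd (lag_dm E L)"
      show "U \<in> snd (lag_dm (E - {e}) (lag_restr E (E - {e}) L))" unfolding restr
      proof (intro conjI ballI impI allI U)
        fix v d b assume v: "v \<in> L" "\<forall>d\<in>E - {e}. v (d, d \<notin> U) = 0" and d: "d \<in> E - {e}"
        \<comment> \<open>Adding the unit vector clears the coordinate \<open>(e, False)\<close> and
          changes no other one, so the test for \<open>U\<close> after deletion becomes the test for
          \<open>insert e U\<close>.\<close>
        let ?w = "if v (e, False) = 0 then v else (\<lambda>p. v p + ?\<delta> p)"
        have "?w \<in> L" using v(1) lagrangian_add[OF L v(1) True] by simp
        moreover have "\<forall>d\<in>E. ?w (d, d \<notin> insert e U) = 0"
        proof
          fix d assume "d \<in> E"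
          then show "?w (d, d \<notin> insert e U) = 0" using v(2)[rule_format, of d] by (cases "d = e") simp_all
        qed
        ultimately have "?w (d, b) = 0" using F d unfolding mem_lag_dm by blast
        then show "v (d, b) = 0" using d by (auto split: if_splits)
      qed
    qed
    moreover have "del e (lag_dm E L) = (E - {e}, (\<lambda>\<phi>. \<phi> - {e}) ` snd (lag_dm E L))"
      using coloop by (simp add: del_def)
    moreover have "U \<in> (\<lambda>\<phi>. \<phi> - {e}) ` snd (lag_dm E L) \<longleftrightarrow> U \<subseteq> E - {e} \<and> insert e U \<in> snd (lag_dm E L)" for U
    proof
      assume "U \<in> (\<lambda>\<phi>. \<phi> - {e}) ` snd (lag_dm E L)"
      then obtain \<phi> where \<phi>: "\<phi> \<in> snd (lag_dm E L)" "U = \<phi> - {e}" by blast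
      then show "U \<subseteq> E - {e} \<and> insert e U \<in> snd (lag_dm E L)"
        using coloop[OF \<phi>(1)] by (auto simp: insert_absorb mem_lag_dm)
    next
      assume "U \<subseteq> E - {e} \<and> insert e U \<in> snd (lag_dm E L)"
      then show "U \<in> (\<lambda>\<phi>. \<phi> - {e}) ` snd (lag_dm E L)" by (intro image_eqI[of _ _ "insert e U"]) auto
    qed
    ultimately show ?thesis using restr by (intro prod_eqI Set.set_eqI) auto
  next
    case False
    have "U \<in> snd (lag_dm (E - {e}) (lag_restr E (E - {e}) L)) \<longleftrightarrow> U \<in> snd (lag_dm E L)"
      if U: "U \<subseteq> E - {e}" for U
    proof
      assume F: "U \<in> snd (lag_dm (E - {e}) (lag_restr E (E - {e}) L))"
      show "U \<in> snd (lag_dm E L)" unfolding mem_lag_dm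
      proof (intro conjI ballI impI allI)
        fix v d b assume v: "v \<in> L" "\<forall>d\<in>E. v (d, d \<notin> U) = 0" and d: "d \<in> E"
        have T0: "v (e, True) = 0" using v(2)[rule_format, OF e] subsetD[OF U, of e] by (cases "e \<in> U") simp_all
        then have z: "\<forall>d\<in>E - {e}. \<forall>b. v (d, b) = 0" using F v unfolding restr by blast
        \<comment> \<open>Otherwise \<open>v\<close> would agree on \<open>E\<close> with the
          excluded unit vector.\<close>
        have "v (e, False) = 0"
        proof (rule ccontr)
          assume "v (e, False) \<noteq> 0"
          then have "?\<delta> (d, b) = v (d, b)" if "d \<in> E" for d b
            using that z T0 by (cases "d = e"; cases b) auto
          then have "?\<delta> \<in> L" by (rule lagrangian_cong[OF L v(1)])
          then show False using False by blast
        qed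
        then show "v (d, b) = 0" using z T0 d by (cases "d = e"; cases b) auto
      qed (use U in auto)
    next
      assume F: "U \<in> snd (lag_dm E L)"
      show "U \<in> snd (lag_dm (E - {e}) (lag_restr E (E - {e}) L))" unfolding restr
      proof (intro conjI ballI impI allI U)
        fix v d b assume v: "v \<in> L" "v (e, True) = 0" "\<forall>d\<in>E - {e}. v (d, d \<notin> U) = 0" and d: "d \<in> E - {e}"
        have "v (d, d \<notin> U) = 0" if "d \<in> E" for d
        proof (cases "d = e")
          case True
          then show ?thesis using v(2) subsetD[OF U, of e] by (cases "e \<in> U") simp_all
        next
          case False
          then show ?thesis using v(3) that by simp
        qed
        from lag_dm_feasibleD[OF F v(1) this] show "v (d, b) = 0" using d by blast
      qed
    qed
    moreover have "del e (lag_dm E L) = (E - {e}, {\<phi> \<in> snd (lag_dm E L). e \<notin> \<phi>})"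
      using exists_feasible_avoiding[OF fin e L False ne] by (auto simp: del_def)
    moreover have "U \<in> {\<phi> \<in> snd (lag_dm E L). e \<notin> \<phi>} \<longleftrightarrow> U \<subseteq> E - {e} \<and> U \<in> snd (lag_dm E L)" for U
      by (auto simp: mem_lag_dm)
    ultimately show ?thesis using restr by (intro prod_eqI Set.set_eqI) auto
  qed
qed

text \<open>Reduction in stages: the same vector of \<open>L\<close> witnesses both sides, because
  the vanishing conditions on \<open>E - A\<close> and \<open>A - B\<close> combine to the one on
  \<open>E - B\<close>.\<close>

lemma lag_restr_trans:
  assumes "B \<subseteq> A" "A \<subseteq> E"
  shows "lag_restr A B (lag_restr E A L) = lag_restr E B L"
proof (intro Set.set_eqI iffI)
  fix w assume "w \<in> lag_restr A B (lag_restr E A L)"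
  then obtain u v where v: "v \<in> L" "\<forall>e\<in>E - A. v (e, True) = 0" "\<forall>e\<in>A. \<forall>b. u (e, b) = v (e, b)"
    and u: "\<forall>e\<in>A - B. u (e, True) = 0" "\<forall>e\<in>B. \<forall>b. w (e, b) = u (e, b)"
    unfolding lag_restr_def by blast
  have "\<forall>e\<in>E - B. v (e, True) = 0" using v u by auto
  moreover have "\<forall>e\<in>B. \<forall>b. w (e, b) = v (e, b)" using v u assms by auto
  ultimately show "w \<in> lag_restr E B L" using v(1) unfolding lag_restr_def by blast
next
  fix w assume "w \<in> lag_restr E B L"
  then obtain v where v: "v \<in> L" "\<forall>e\<in>E - B. v (e, True) = 0" "\<forall>e\<in>B. \<forall>b. w (e, b) = v (e, b)"
    unfolding lag_restr_def by blast
  have "v \<in> lag_restr E A L" using v assms unfolding lag_restr_def by blast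
  then show "w \<in> lag_restr A B (lag_restr E A L)"
    using v assms unfolding lag_restr_def[of A] by blast
qed

lemma lag_restr_self:
  assumes "lagrangian E L" shows "lag_restr E E L = L"
proof
  show "L \<subseteq> lag_restr E E L" unfolding lag_restr_def by blast
  show "lag_restr E E L \<subseteq> L"
  proof
    fix w assume "w \<in> lag_restr E E L"
    then obtain v where "v \<in> L" "\<And>e b. e \<in> E \<Longrightarrow> w (e, b) = v (e, b)" unfolding lag_restr_def by blast
    then show "w \<in> L" by (rule lagrangian_cong[OF assms])
  qed
qed

lemma snd_del_nonempty: "snd D \<noteq> {} \<Longrightarrow> snd (del e D) \<noteq> {}"
  by (auto simp: del_def)

text \<open>The Lagrangian property and the nonempty family belong to the conclusion because each
  further application of \<open>del_lag_dm\<close> asks for both.\<close>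

lemma fold_del_lag_dm:
  assumes "finite E" "lagrangian E L" "snd (lag_dm E L) \<noteq> {}" "distinct xs" "set xs \<subseteq> E"
  shows "lagrangian (E - set xs) (lag_restr E (E - set xs) L) \<and>
    snd (lag_dm (E - set xs) (lag_restr E (E - set xs) L)) \<noteq> {} \<and>
    fold del xs (lag_dm E L) = lag_dm (E - set xs) (lag_restr E (E - set xs) L)"
  using assms
proof (induction xs arbitrary: E L)
  case Nil
  then show ?case by (simp add: lag_restr_self)
next
  case (Cons e xs)
  let ?E = "E - {e}" and ?L = "lag_restr E (E - {e}) L"
  have e: "e \<in> E" and xs: "set xs \<subseteq> ?E" "distinct xs" using Cons.prems by auto
  have del: "del e (lag_dm E L) = lag_dm ?E ?L" by (rule del_lag_dm[OF Cons.prems(1) e Cons.prems(2,3)])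
  have ne: "snd (lag_dm ?E ?L) \<noteq> {}"
    using snd_del_nonempty[OF Cons.prems(3), of e] unfolding del .
  have E: "?E - set xs = E - set (e # xs)" by auto
  have "lag_restr ?E (?E - set xs) ?L = lag_restr E (?E - set xs) L"
    by (rule lag_restr_trans) auto
  with Cons.IH[OF _ lagrangian_delete[OF Cons.prems(1) e Cons.prems(2)] ne xs(2,1)] Cons.prems(1)
  show ?case by (simp add: del E)
qed

lemma
  assumes "finite E" "lagrangian E L" "snd (lag_dm E L) \<noteq> {}" "A \<subseteq> E"
  shows lagrangian_restr: "lagrangian A (lag_restr E A L)"
    and restr_lag_dm: "restr (lag_dm E L) A = lag_dm A (lag_restr E A L)"
    and snd_lag_dm_restr: "snd (lag_dm A (lag_restr E A L)) \<noteq> {}"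
proof -
  have "set (sorted_list_of_set (E - A)) = E - A" "E - (E - A) = A" using assms by auto
  then show "lagrangian A (lag_restr E A L)" "restr (lag_dm E L) A = lag_dm A (lag_restr E A L)"
    "snd (lag_dm A (lag_restr E A L)) \<noteq> {}"
    using fold_del_lag_dm[OF assms(1-3), of "sorted_list_of_set (E - A)"] by (auto simp: restr_def)
qed

lemma lag_restr_Int:
  assumes disj: "E1 \<inter> E2 = {}" and L: "lagrangian E1 L1" "lagrangian E2 L2" and A: "A1 \<subseteq> E1" "A2 \<subseteq> E2"
  shows "lag_restr (E1 \<union> E2) (A1 \<union> A2) (L1 \<inter> L2) = lag_restr E1 A1 L1 \<inter> lag_restr E2 A2 L2"
proof (intro Set.set_eqI iffI IntI)
  fix w assume "w \<in> lag_restr (E1 \<union> E2) (A1 \<union> A2) (L1 \<inter> L2)"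
  then obtain v where v: "v \<in> L1" "v \<in> L2" "\<forall>e\<in>E1 \<union> E2 - (A1 \<union> A2). v (e, True) = 0"
    "\<forall>e\<in>A1 \<union> A2. \<forall>b. w (e, b) = v (e, b)" unfolding lag_restr_def by blast
  have "\<forall>e\<in>E1 - A1. v (e, True) = 0" "\<forall>e\<in>E2 - A2. v (e, True) = 0" using v(3) A disj by auto
  then show "w \<in> lag_restr E1 A1 L1" "w \<in> lag_restr E2 A2 L2" using v unfolding lag_restr_def by auto
next
  fix w assume "w \<in> lag_restr E1 A1 L1 \<inter> lag_restr E2 A2 L2"
  then obtain v1 v2 where v1: "v1 \<in> L1" "\<forall>e\<in>E1 - A1. v1 (e, True) = 0" "\<forall>e\<in>A1. \<forall>b. w (e, b) = v1 (e, b)"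
    and v2: "v2 \<in> L2" "\<forall>e\<in>E2 - A2. v2 (e, True) = 0" "\<forall>e\<in>A2. \<forall>b. w (e, b) = v2 (e, b)"
    unfolding lag_restr_def by blast
  \<comment> \<open>The two witnesses are glued along the disjoint ground sets; each Lagrangian sees
    only its own part.\<close>
  let ?v = "\<lambda>(e, b). if e \<in> E1 then v1 (e, b) else v2 (e, b)"
  have s2: "e \<notin> E1" if "e \<in> E2" for e using that disj by blast
  have "?v \<in> L1" using lagrangian_cong[OF L(1) v1(1), of ?v] by simp
  moreover have "?v \<in> L2" using lagrangian_cong[OF L(2) v2(1), of ?v] s2 by simp
  moreover have "\<forall>e\<in>E1 \<union> E2 - (A1 \<union> A2). ?v (e, True) = 0" using v1(2) v2(2) by auto
  moreover have "\<forall>e\<in>A1 \<union> A2. \<forall>b. w (e, b) = ?v (e, b)" using v1(3) v2(3) A s2 by auto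
  ultimately show "w \<in> lag_restr (E1 \<union> E2) (A1 \<union> A2) (L1 \<inter> L2)" unfolding lag_restr_def by blast
qed

lemma lag_restr_image:
  assumes f: "inj_on f E" and L: "lagrangian E L" and A: "A \<subseteq> E"
  shows "lag_restr (f ` E) (f ` A) (lag_image f L) = lag_image f (lag_restr E A L)"
proof (intro Set.set_eqI iffI)
  have EA: "f ` E - f ` A = f ` (E - A)" using inj_on_image_set_diff[OF f _ A, of E] by auto
  fix w
  {
    assume "w \<in> lag_restr (f ` E) (f ` A) (lag_image f L)"
    then obtain v where v: "(\<lambda>(e, b). v (f e, b)) \<in> L" "\<forall>e\<in>E - A. v (f e, True) = 0"
      "\<forall>e\<in>A. \<forall>b. w (f e, b) = v (f e, b)"
      unfolding lag_restr_def lag_image_def EA by auto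
    then show "w \<in> lag_image f (lag_restr E A L)"
      unfolding lag_restr_def lag_image_def by (auto intro!: bexI[OF _ v(1)])
  next
    assume "w \<in> lag_image f (lag_restr E A L)"
    then obtain u where u: "u \<in> L" "\<forall>e\<in>E - A. u (e, True) = 0" "\<forall>e\<in>A. \<forall>b. w (f e, b) = u (e, b)"
      unfolding lag_restr_def lag_image_def by auto
    obtain v where v: "v \<in> lag_image f L" "\<And>e b. e \<in> E \<Longrightarrow> v (f e, b) = u (e, b)"
      by (rule lift_vct_image[OF f L u(1)]) blast
    have "\<forall>e\<in>f ` (E - A). v (e, True) = 0" using u(2) v(2) by auto
    moreover have "\<forall>e\<in>f ` A. \<forall>b. w (e, b) = v (e, b)" using u(3) v(2) A by auto
    ultimately show "w \<in> lag_restr (f ` E) (f ` A) (lag_image f L)"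
      using v(1) unfolding lag_restr_def EA by blast
  }
qed

section \<open>Restriction of binary delta-matroids\<close>

lemma binary_dmE:
  assumes "binary_dm D"
  obtains E L where "finite E" "lagrangian E L" "snd (lag_dm E L) \<noteq> {}" "D = lag_dm E L"
proof -
  obtain L where L: "lagrangian (fst D) L" "D = lag_dm (fst D) L" by (rule binary_dm_lagrangian[OF assms])
  have "finite (fst D)" "snd D \<noteq> {}" using assms by (auto simp: binary_dm_def set_system_def)
  then show ?thesis using that[OF _ L(1)] L(2) by metis
qed

lemma binary_dm_finite: "binary_dm D \<Longrightarrow> finite (fst D)"
  by (simp add: binary_dm_def set_system_def)

lemma
  assumes "binary_dm D" "A \<subseteq> fst D"
  shows binary_dm_restr: "binary_dm (restr D A)" and fst_restr: "fst (restr D A) = A"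
proof -
  obtain E L where L: "finite E" "lagrangian E L" "snd (lag_dm E L) \<noteq> {}" and D: "D = lag_dm E L"
    by (rule binary_dmE[OF assms(1)])
  have A: "A \<subseteq> E" using assms(2) D by simp
  show "binary_dm (restr D A)" "fst (restr D A) = A" unfolding D restr_lag_dm[OF L A]
    by (auto intro!: binary_dm_lag_dm lagrangian_restr[OF L A] snd_lag_dm_restr[OF L A] finite_subset[OF A L(1)])
qed

lemma restr_self: "restr D (fst D) = D"
  by (simp add: restr_def)

text \<open>Both sides are the reduction to \<open>B\<close>, once in two stages and once directly.
  Coassociativity rests on this.\<close>

lemma restr_restr:
  assumes "binary_dm D" "B \<subseteq> A" "A \<subseteq> fst D"
  shows "restr (restr D A) B = restr D B"
proof -
  obtain E L where L: "finite E" "lagrangian E L" "snd (lag_dm E L) \<noteq> {}" and D: "D = lag_dm E L"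
    by (rule binary_dmE[OF assms(1)])
  have A: "A \<subseteq> E" and B: "B \<subseteq> E" using assms D by auto
  show ?thesis unfolding D restr_lag_dm[OF L A] restr_lag_dm[OF L B]
    using restr_lag_dm[OF finite_subset[OF A L(1)] lagrangian_restr[OF L A] snd_lag_dm_restr[OF L A] assms(2)]
    by (simp add: lag_restr_trans[OF assms(2) A])
qed

lemma snd_ss_image_empty [simp]: "snd (ss_image f D) = {} \<longleftrightarrow> snd D = {}"
  by (simp add: ss_image_def)

lemma binary_dm_image:
  assumes "binary_dm D" "inj_on f (fst D)"
  shows "binary_dm (ss_image f D)"
proof -
  obtain E L where L: "finite E" "lagrangian E L" "snd (lag_dm E L) \<noteq> {}" and D: "D = lag_dm E L"
    by (rule binary_dmE[OF assms(1)])
  have f: "inj_on f E" using assms(2) D by simp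
  have "snd (ss_image f (lag_dm E L)) \<noteq> {}" using L(3) by simp
  then show ?thesis unfolding D lag_dm_image[OF f L(2), symmetric]
    by (intro binary_dm_lag_dm lagrangian_image f L finite_imageI)
qed

lemma restr_image:
  assumes "binary_dm D" "inj_on f (fst D)" "A \<subseteq> fst D"
  shows "restr (ss_image f D) (f ` A) = ss_image f (restr D A)"
proof -
  obtain E L where L: "finite E" "lagrangian E L" "snd (lag_dm E L) \<noteq> {}" and D: "D = lag_dm E L"
    by (rule binary_dmE[OF assms(1)])
  have f: "inj_on f E" and A: "A \<subseteq> E" using assms(2,3) D by simp_all
  have fA: "inj_on f A" using f A by (rule inj_on_subset)
  have ne: "snd (lag_dm (f ` E) (lag_image f L)) \<noteq> {}"
    unfolding lag_dm_image[OF f L(2)] using L(3) by simp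
  have "restr (ss_image f D) (f ` A) = lag_dm (f ` A) (lag_image f (lag_restr E A L))"
    unfolding D lag_dm_image[OF f L(2), symmetric]
    using restr_lag_dm[OF finite_imageI[OF L(1)] lagrangian_image[OF f L(2)] ne image_mono[OF A]]
    by (simp add: lag_restr_image[OF f L(2) A])
  also have "\<dots> = ss_image f (restr D A)"
    unfolding D restr_lag_dm[OF L A] by (rule lag_dm_image[OF fA lagrangian_restr[OF L A]])
  finally show ?thesis .
qed

lemma
  assumes "binary_dm D1" "binary_dm D2" "fst D1 \<inter> fst D2 = {}"
  shows binary_dm_dsum: "binary_dm (dsum D1 D2)"
    and restr_dsum: "A1 \<subseteq> fst D1 \<Longrightarrow> A2 \<subseteq> fst D2 \<Longrightarrow>
      restr (dsum D1 D2) (A1 \<union> A2) = dsum (restr D1 A1) (restr D2 A2)"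
proof -
  obtain E1 L1 where L1: "finite E1" "lagrangian E1 L1" "snd (lag_dm E1 L1) \<noteq> {}" and D1: "D1 = lag_dm E1 L1"
    by (rule binary_dmE[OF assms(1)])
  obtain E2 L2 where L2: "finite E2" "lagrangian E2 L2" "snd (lag_dm E2 L2) \<noteq> {}" and D2: "D2 = lag_dm E2 L2"
    by (rule binary_dmE[OF assms(2)])
  have disj: "E1 \<inter> E2 = {}" using assms(3) D1 D2 by simp
  note un = lag_dm_Int[OF disj L1(2) L2(2)]
  have L: "lagrangian (E1 \<union> E2) (L1 \<inter> L2)" by (rule lagrangian_Int[OF L1(1) L2(1) disj L1(2) L2(2)])
  have ne: "snd (lag_dm (E1 \<union> E2) (L1 \<inter> L2)) \<noteq> {}"
    unfolding un using L1(3) L2(3) by (auto simp: dsum_def)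
  show "binary_dm (dsum D1 D2)" unfolding D1 D2 un[symmetric]
    using L1(1) L2(1) L ne by (intro binary_dm_lag_dm) auto
  assume A: "A1 \<subseteq> fst D1" "A2 \<subseteq> fst D2"
  then have A1: "A1 \<subseteq> E1" and A2: "A2 \<subseteq> E2" using D1 D2 by auto
  have "restr (dsum D1 D2) (A1 \<union> A2) = lag_dm (A1 \<union> A2) (lag_restr (E1 \<union> E2) (A1 \<union> A2) (L1 \<inter> L2))"
    unfolding D1 D2 un[symmetric] using L1(1) L2(1) A1 A2 by (intro restr_lag_dm L ne) auto
  also have "\<dots> = dsum (lag_dm A1 (lag_restr E1 A1 L1)) (lag_dm A2 (lag_restr E2 A2 L2))"
    unfolding lag_restr_Int[OF disj L1(2) L2(2) A1 A2] using disj A1 A2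
    by (intro lag_dm_Int lagrangian_restr[OF L1 A1] lagrangian_restr[OF L2 A2]) auto
  also have "\<dots> = dsum (restr D1 A1) (restr D2 A2)"
    unfolding D1 D2 restr_lag_dm[OF L1 A1] restr_lag_dm[OF L2 A2] ..
  finally show "restr (dsum D1 D2) (A1 \<union> A2) = dsum (restr D1 A1) (restr D2 A2)" .
qed

subsection \<open>Isomorphism classes and their product\<close>

lemma feasible_subset: "set_system D \<Longrightarrow> \<phi> \<in> snd D \<Longrightarrow> \<phi> \<subseteq> fst D"
  by (auto simp: set_system_def)

lemma feasible_finite: "set_system D \<Longrightarrow> \<phi> \<in> snd D \<Longrightarrow> finite \<phi>"
  by (meson feasible_subset finite_subset set_system_def)

lemma set_system_del: "set_system D \<Longrightarrow> set_system (del e D)"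
  by (auto simp: set_system_def del_def)

section \<open>Parity of feasible sets under deletion, direct sum and relabeling\<close>

lemma even_ssI: "(\<And>\<phi>. \<phi> \<in> snd D \<Longrightarrow> even (card \<phi>) = b) \<Longrightarrow> even_ss D"
  unfolding even_ss_def by blast

lemma even_ssE:
  assumes "even_ss D" obtains b where "\<And>\<phi>. \<phi> \<in> snd D \<Longrightarrow> even (card \<phi>) = b"
  using assms unfolding even_ss_def by metis

text \<open>Contracting a coloop lowers every cardinality by one and flips the common parity; an
  ordinary deletion passes to a subfamily.\<close>

lemma even_ss_del:
  assumes "set_system D" "even_ss D"
  shows "even_ss (del e D)"
proof (cases "\<forall>\<phi>\<in>snd D. e \<in> \<phi>")
  case True
  obtain b where b: "\<And>\<phi>. \<phi> \<in> snd D \<Longrightarrow> even (card \<phi>) = b" by (rule even_ssE[OF assms(2)]) blast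
  have eq: "even (card (\<phi> - {e})) = (\<not> b)" if "\<phi> \<in> snd D" for \<phi>
  proof -
    have "finite \<phi>" by (rule feasible_finite[OF assms(1) that])
    then have "card \<phi> = Suc (card (\<phi> - {e}))" using True that by (intro card.remove) auto
    then show ?thesis using b[OF that] by auto
  qed
  show ?thesis
  proof (rule even_ssI)
    fix \<psi> assume "\<psi> \<in> snd (del e D)"
    then obtain \<phi> where "\<phi> \<in> snd D" "\<psi> = \<phi> - {e}" using True unfolding del_def by auto
    then show "even (card \<psi>) = (\<not> b)" using eq by blast
  qed
next
  case False
  then have "snd (del e D) \<subseteq> snd D" by (auto simp: del_def)
  then show ?thesis using assms(2) unfolding even_ss_def by blast
qed

lemma even_ss_restr:
  assumes "set_system D" "even_ss D"
  shows "even_ss (restr D A)"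
proof -
  have "set_system (fold del xs D) \<and> even_ss (fold del xs D)" for xs
    using assms by (induction xs arbitrary: D) (auto simp: set_system_del even_ss_del)
  then show ?thesis by (simp add: restr_def)
qed

lemma even_ss_dsum:
  assumes "set_system D1" "set_system D2" "fst D1 \<inter> fst D2 = {}" "even_ss D1" "even_ss D2"
  shows "even_ss (dsum D1 D2)"
proof -
  have card: "card (\<phi>1 \<union> \<phi>2) = card \<phi>1 + card \<phi>2" if "\<phi>1 \<in> snd D1" "\<phi>2 \<in> snd D2" for \<phi>1 \<phi>2
    using feasible_subset[OF assms(1) that(1)] feasible_subset[OF assms(2) that(2)] assms(3)
    by (intro card_Un_disjoint feasible_finite[OF assms(1) that(1)] feasible_finite[OF assms(2) that(2)]) auto
  obtain b1 where b1: "\<And>\<phi>. \<phi> \<in> snd D1 \<Longrightarrow> even (card \<phi>) = b1" by (rule even_ssE[OF assms(4)]) blast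
  obtain b2 where b2: "\<And>\<phi>. \<phi> \<in> snd D2 \<Longrightarrow> even (card \<phi>) = b2" by (rule even_ssE[OF assms(5)]) blast
  show ?thesis
  proof (rule even_ssI)
    fix \<psi> assume "\<psi> \<in> snd (dsum D1 D2)"
    then obtain \<phi>1 \<phi>2 where "\<phi>1 \<in> snd D1" "\<phi>2 \<in> snd D2" "\<psi> = \<phi>1 \<union> \<phi>2" unfolding dsum_def by auto
    then show "even (card \<psi>) = (b1 = b2)" using b1 b2 by (simp add: card)
  qed
qed

lemma even_ss_image:
  assumes "set_system D" "inj_on f (fst D)" "even_ss D"
  shows "even_ss (ss_image f D)"
proof -
  have card: "card (f ` \<phi>) = card \<phi>" if "\<phi> \<in> snd D" for \<phi>
    using feasible_subset[OF assms(1) that] by (intro card_image inj_on_subset[OF assms(2)])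
  obtain b where b: "\<And>\<phi>. \<phi> \<in> snd D \<Longrightarrow> even (card \<phi>) = b" by (rule even_ssE[OF assms(3)]) blast
  show ?thesis
  proof (rule even_ssI)
    fix \<psi> assume "\<psi> \<in> snd (ss_image f D)"
    then obtain \<phi> where "\<phi> \<in> snd D" "\<psi> = f ` \<phi>" unfolding ss_image_def by auto
    then show "even (card \<psi>) = b" using card b by simp
  qed
qed

section \<open>Isomorphism classes and their representatives\<close>

lemma ss_image_comp: "ss_image g (ss_image f D) = ss_image (g \<circ> f) D"
  by (simp add: ss_image_def image_comp)

lemma ss_image_ident:
  assumes "set_system D" "\<And>e. e \<in> fst D \<Longrightarrow> f e = e"
  shows "ss_image f D = D"
proof (intro prod_eqI)
  have "f ` \<phi> = \<phi>" if "\<phi> \<subseteq> fst D" for \<phi> using assms(2) that by force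
  moreover have "\<phi> \<subseteq> fst D" if "\<phi> \<in> snd D" for \<phi> using assms(1) that by (auto simp: set_system_def)
  ultimately show "snd (ss_image f D) = snd D" "fst (ss_image f D) = fst D" by (simp_all add: ss_image_def)
qed

lemma binary_dm_set_system: "binary_dm D \<Longrightarrow> set_system D"
  by (simp add: binary_dm_def)

lemma mem_ss_class:
  "D' \<in> ss_class D \<longleftrightarrow> set_system D' \<and> (\<exists>f. inj_on f (fst D) \<and> D' = ss_image f D)"
  by (simp add: ss_class_def ss_iso_iff_image)

lemma ss_class_self: "set_system D \<Longrightarrow> D \<in> ss_class D"
  unfolding mem_ss_class by (auto intro!: exI[of _ "\<lambda>x. x"] simp: ss_image_ident)

lemma ss_class_image_subset:
  assumes "inj_on f (fst D)" shows "ss_class (ss_image f D) \<subseteq> ss_class D"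
proof
  fix D' assume "D' \<in> ss_class (ss_image f D)"
  then obtain g where "set_system D'" "inj_on g (f ` fst D)" "D' = ss_image (g \<circ> f) D"
    unfolding mem_ss_class by (auto simp: ss_image_comp)
  then show "D' \<in> ss_class D" unfolding mem_ss_class using comp_inj_on[OF assms] by blast
qed

lemma ss_class_image:
  assumes D: "set_system D" and f: "inj_on f (fst D)"
  shows "ss_class (ss_image f D) = ss_class D"
proof
  show "ss_class (ss_image f D) \<subseteq> ss_class D" by (rule ss_class_image_subset[OF f])
  let ?g = "inv_into (fst D) f"
  have "ss_image ?g (ss_image f D) = D"
    unfolding ss_image_comp using f by (intro ss_image_ident D) simp
  moreover have "inj_on ?g (fst (ss_image f D))" by (simp add: inj_on_inv_into)
  ultimately show "ss_class D \<subseteq> ss_class (ss_image f D)" using ss_class_image_subset by metis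
qed

lemma rep_ss_class:
  assumes "set_system D"
  obtains f where "inj_on f (fst D)" "rep (ss_class D) = ss_image f D"
proof -
  have "rep (ss_class D) \<in> ss_class D" unfolding rep_def using ss_class_self[OF assms] by (rule someI)
  then show ?thesis using that unfolding mem_ss_class by blast
qed

lemma deg_ss_class:
  assumes "set_system D" shows "deg (ss_class D) = card (fst D)"
proof -
  obtain f where f: "inj_on f (fst D)" "rep (ss_class D) = ss_image f D" by (rule rep_ss_class[OF assms])
  then show ?thesis by (simp add: deg_def card_image)
qed

lemma BDM_E:
  assumes "C \<in> BDM" obtains D where "binary_dm D" "C = ss_class D"
  using assms unfolding BDM_def by blast

lemma BDM_even_E:
  assumes "C \<in> BDM_even" obtains D where "binary_dm D" "even_ss D" "C = ss_class D"
  using assms unfolding BDM_even_def by blast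

lemma BDM_I: "binary_dm D \<Longrightarrow> ss_class D \<in> BDM"
  by (simp add: BDM_def)

lemma BDM_even_I: "binary_dm D \<Longrightarrow> even_ss D \<Longrightarrow> ss_class D \<in> BDM_even"
  by (simp add: BDM_even_def)

lemma BDM_even_subset: "BDM_even \<subseteq> BDM"
  by (auto simp: BDM_def BDM_even_def)

text \<open>The ground set is shifted beyond all elements of \<open>F\<close>. Evenness is carried
  along so that the same representative serves for products in the even part.\<close>

lemma disjoint_representative:
  assumes "binary_dm D" "finite F"
  obtains D' where "binary_dm D'" "ss_class D' = ss_class D" "fst D' \<inter> F = {}" "even_ss D \<longrightarrow> even_ss D'"
proof -
  obtain N where N: "\<And>x. x \<in> F \<Longrightarrow> x < N"
    using assms(2) unfolding finite_nat_set_iff_bounded by blast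
  let ?f = "\<lambda>x. x + N"
  have inj: "inj_on ?f (fst D)" by (simp add: inj_on_def)
  have "fst (ss_image ?f D) \<inter> F = {}" by (auto dest: N)
  with binary_dm_image[OF assms(1) inj] ss_class_image[OF binary_dm_set_system[OF assms(1)] inj]
  show ?thesis using impI[OF even_ss_image[OF binary_dm_set_system[OF assms(1)] inj]] by (rule that)
qed

section \<open>The product of isomorphism classes\<close>

lemma mem_dsum: "W \<in> snd (dsum D1 D2) \<longleftrightarrow> (\<exists>\<phi>1 \<phi>2. \<phi>1 \<in> snd D1 \<and> \<phi>2 \<in> snd D2 \<and> W = \<phi>1 \<union> \<phi>2)"
  unfolding dsum_def by auto

lemma mem_ss_image: "W \<in> snd (ss_image f D) \<longleftrightarrow> (\<exists>\<phi>. \<phi> \<in> snd D \<and> W = f ` \<phi>)"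
  unfolding ss_image_def by auto

lemma dsum_image:
  assumes D: "set_system D1" "set_system D2" and disj: "fst D1 \<inter> fst D2 = {}"
  shows "dsum (ss_image f D1) (ss_image g D2) =
    ss_image (\<lambda>e. if e \<in> fst D1 then f e else g e) (dsum D1 D2)"
proof -
  let ?h = "\<lambda>e. if e \<in> fst D1 then f e else g e"
  have h: "?h ` (A \<union> B) = f ` A \<union> g ` B" if "A \<subseteq> fst D1" "B \<subseteq> fst D2" for A B
  proof -
    have "?h ` A = f ` A" using that by (intro image_cong) auto
    moreover have "?h ` B = g ` B" using that disj by (intro image_cong) auto
    ultimately show ?thesis by (simp only: image_Un)
  qed
  have sub: "\<phi>1 \<subseteq> fst D1" "\<phi>2 \<subseteq> fst D2" if "\<phi>1 \<in> snd D1" "\<phi>2 \<in> snd D2" for \<phi>1 \<phi>2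
    using D that by (auto simp: set_system_def)
  show ?thesis
  proof (intro prod_eqI)
    show "fst (dsum (ss_image f D1) (ss_image g D2)) = fst (ss_image ?h (dsum D1 D2))"
      unfolding fst_ss_image dsum_def fst_conv by (rule h[symmetric]) auto
    show "snd (dsum (ss_image f D1) (ss_image g D2)) = snd (ss_image ?h (dsum D1 D2))"
    proof (intro Set.set_eqI iffI)
      fix W assume "W \<in> snd (dsum (ss_image f D1) (ss_image g D2))"
      then obtain \<phi>1 \<phi>2 where \<phi>: "\<phi>1 \<in> snd D1" "\<phi>2 \<in> snd D2" "W = f ` \<phi>1 \<union> g ` \<phi>2"
        unfolding mem_dsum mem_ss_image by blast
      then have "W = ?h ` (\<phi>1 \<union> \<phi>2)" using h[OF sub[OF \<phi>(1,2)]] by simp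
      moreover have "\<phi>1 \<union> \<phi>2 \<in> snd (dsum D1 D2)" unfolding mem_dsum using \<phi>(1,2) by blast
      ultimately show "W \<in> snd (ss_image ?h (dsum D1 D2))" unfolding mem_ss_image by blast
    next
      fix W assume "W \<in> snd (ss_image ?h (dsum D1 D2))"
      then obtain \<phi>1 \<phi>2 where \<phi>: "\<phi>1 \<in> snd D1" "\<phi>2 \<in> snd D2" "W = ?h ` (\<phi>1 \<union> \<phi>2)"
        unfolding mem_dsum mem_ss_image by blast
      then have "W = f ` \<phi>1 \<union> g ` \<phi>2" using h[OF sub[OF \<phi>(1,2)]] by simp
      then show "W \<in> snd (dsum (ss_image f D1) (ss_image g D2))"
        unfolding mem_dsum mem_ss_image using \<phi>(1,2) by blast
    qed
  qed
qed

text \<open>\<open>cmult\<close> collects the sums of all disjoint pairs of representatives; the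
  lemma shows that one such pair already determines the product.\<close>

lemma cmult_ss_class:
  assumes D: "set_system D1" "set_system D2" and disj: "fst D1 \<inter> fst D2 = {}"
  shows "cmult (ss_class D1) (ss_class D2) = ss_class (dsum D1 D2)"
proof
  show "ss_class (dsum D1 D2) \<subseteq> cmult (ss_class D1) (ss_class D2)"
    using ss_class_self[OF D(1)] ss_class_self[OF D(2)] disj
    unfolding cmult_def ss_class_def[of "dsum D1 D2"] by blast
  show "cmult (ss_class D1) (ss_class D2) \<subseteq> ss_class (dsum D1 D2)"
  proof
    fix X assume "X \<in> cmult (ss_class D1) (ss_class D2)"
    then obtain D1' D2' where D': "D1' \<in> ss_class D1" "D2' \<in> ss_class D2" "fst D1' \<inter> fst D2' = {}"
      and X: "X \<in> ss_class (dsum D1' D2')"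
      unfolding cmult_def ss_class_def by blast
    obtain f where f: "inj_on f (fst D1)" "D1' = ss_image f D1" using D'(1) mem_ss_class by blast
    obtain g where g: "inj_on g (fst D2)" "D2' = ss_image g D2" using D'(2) mem_ss_class by blast
    \<comment> \<open>The relabelings of the summands glue to one of the sum; it is injective
      because the chosen representatives are disjoint.\<close>
    let ?h = "\<lambda>e. if e \<in> fst D1 then f e else g e"
    have "f ` fst D1 \<inter> g ` fst D2 = {}" using D'(3) f g by simp
    then have ne: "f x \<noteq> g y" if "x \<in> fst D1" "y \<in> fst D2" for x y using that by blast
    have "inj_on ?h (fst D1 \<union> fst D2)"
    proof (rule inj_onI)
      fix x y assume xy: "x \<in> fst D1 \<union> fst D2" "y \<in> fst D1 \<union> fst D2" "?h x = ?h y"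
      show "x = y"
        using xy ne[of x y] ne[of y x] inj_onD[OF f(1), of x y] inj_onD[OF g(1), of x y]
        by (cases "x \<in> fst D1"; cases "y \<in> fst D1") auto
    qed
    then have "inj_on ?h (fst (dsum D1 D2))" by (simp add: dsum_def)
    from ss_class_image_subset[OF this] show "X \<in> ss_class (dsum D1 D2)"
      using X unfolding f(2) g(2) dsum_image[OF D disj] by blast
  qed
qed

lemma fst_dsum [simp]: "fst (dsum D1 D2) = fst D1 \<union> fst D2"
  by (simp add: dsum_def)

lemma dsum_commute: "dsum D1 D2 = dsum D2 D1"
  by (intro prod_eqI Set.set_eqI) (auto simp: mem_dsum; metis Un_commute)+

lemma dsum_assoc: "dsum (dsum D1 D2) D3 = dsum D1 (dsum D2 D3)"
proof (intro prod_eqI Set.set_eqI)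
  fix W
  show "W \<in> snd (dsum (dsum D1 D2) D3) \<longleftrightarrow> W \<in> snd (dsum D1 (dsum D2 D3))"
    unfolding mem_dsum by (metis Un_assoc)
qed auto

abbreviation empty_ss :: ssys where "empty_ss \<equiv> ({}, {{}})"

lemma dsum_empty_ss: "dsum empty_ss D = D" "dsum D empty_ss = D"
  by (simp_all add: dsum_def)

lemma binary_dm_empty_ss: "binary_dm empty_ss"
proof -
  \<comment> \<open>The empty sum makes the pairing zero, so over the empty ground set the full
    space is its own orthogonal complement.\<close>
  have "lagrangian {} UNIV" by (auto simp: lagrangian_def pairing_def)
  moreover have "lag_dm {} UNIV = empty_ss" by (auto simp: lag_dm_def)
  ultimately show ?thesis using binary_dm_lag_dm[of "{}" UNIV] by simp
qed

lemma binary_dm_fst_empty: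
  assumes "binary_dm D" "fst D = {}" shows "D = empty_ss"
  using assms binary_dm_set_system[OF assms(1)] by (cases D) (auto simp: set_system_def)

lemma cunit_BDM: "cunit \<in> BDM"
  unfolding cunit_def by (rule BDM_I[OF binary_dm_empty_ss])

lemma cunit_BDM_even: "cunit \<in> BDM_even"
  unfolding cunit_def by (rule BDM_even_I[OF binary_dm_empty_ss]) (simp add: even_ss_def)

lemma two_representatives:
  assumes "a \<in> BDM" "b \<in> BDM"
  obtains D1 D2 where "binary_dm D1" "binary_dm D2" "fst D1 \<inter> fst D2 = {}" "a = ss_class D1" "b = ss_class D2"
    "cmult a b = ss_class (dsum D1 D2)"
proof -
  obtain D1 where D1: "binary_dm D1" "a = ss_class D1" by (rule BDM_E[OF assms(1)])
  obtain D where D: "binary_dm D" "b = ss_class D" by (rule BDM_E[OF assms(2)])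
  obtain D2 where D2: "binary_dm D2" "ss_class D2 = ss_class D" "fst D2 \<inter> fst D1 = {}"
    "even_ss D \<longrightarrow> even_ss D2" by (rule disjoint_representative[OF D(1) binary_dm_finite[OF D1(1)]])
  then have disj: "fst D1 \<inter> fst D2 = {}" by blast
  show ?thesis
    using that[OF D1(1) D2(1) disj D1(2)] D(2) D2(2) D1(2)
      cmult_ss_class[OF binary_dm_set_system[OF D1(1)] binary_dm_set_system[OF D2(1)] disj] by simp
qed

lemma cmult_BDM:
  assumes "a \<in> BDM" "b \<in> BDM" shows "cmult a b \<in> BDM"
proof -
  obtain D1 D2 where D: "binary_dm D1" "binary_dm D2" "fst D1 \<inter> fst D2 = {}" "a = ss_class D1" "b = ss_class D2"
    "cmult a b = ss_class (dsum D1 D2)" by (rule two_representatives[OF assms])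
  show ?thesis unfolding D(6) by (rule BDM_I[OF binary_dm_dsum[OF D(1-3)]])
qed

lemma cmult_BDM_even:
  assumes "a \<in> BDM_even" "b \<in> BDM_even" shows "cmult a b \<in> BDM_even"
proof -
  obtain D1 where D1: "binary_dm D1" "even_ss D1" "a = ss_class D1" by (rule BDM_even_E[OF assms(1)])
  obtain D where D: "binary_dm D" "even_ss D" "b = ss_class D" by (rule BDM_even_E[OF assms(2)])
  obtain D2 where D2: "binary_dm D2" "ss_class D2 = ss_class D" "fst D2 \<inter> fst D1 = {}"
    "even_ss D \<longrightarrow> even_ss D2" by (rule disjoint_representative[OF D(1) binary_dm_finite[OF D1(1)]])
  have disj: "fst D1 \<inter> fst D2 = {}" using D2(3) by blast
  note s = binary_dm_set_system[OF D1(1)] binary_dm_set_system[OF D2(1)]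
  have "cmult a b = ss_class (dsum D1 D2)" using cmult_ss_class[OF s disj] D1 D D2 by simp
  then show ?thesis
    using binary_dm_dsum[OF D1(1) D2(1) disj] even_ss_dsum[OF s disj D1(2) mp[OF D2(4) D(2)]] BDM_even_I by simp
qed

lemma cmult_commute:
  assumes "a \<in> BDM" "b \<in> BDM" shows "cmult a b = cmult b a"
proof -
  obtain D1 D2 where D: "binary_dm D1" "binary_dm D2" "fst D1 \<inter> fst D2 = {}" "a = ss_class D1" "b = ss_class D2"
    "cmult a b = ss_class (dsum D1 D2)" by (rule two_representatives[OF assms])
  have "cmult b a = ss_class (dsum D2 D1)" unfolding D(4,5)
    using D(3) by (intro cmult_ss_class binary_dm_set_system D) auto
  then show ?thesis using D(6) dsum_commute by simp
qed

lemma cmult_assoc: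
  assumes "a \<in> BDM" "b \<in> BDM" "c \<in> BDM" shows "cmult (cmult a b) c = cmult a (cmult b c)"
proof -
  obtain D1 D2 where D: "binary_dm D1" "binary_dm D2" "fst D1 \<inter> fst D2 = {}" "a = ss_class D1" "b = ss_class D2"
    "cmult a b = ss_class (dsum D1 D2)" by (rule two_representatives[OF assms(1,2)])
  obtain D where c: "binary_dm D" "c = ss_class D" by (rule BDM_E[OF assms(3)])
  have fin: "finite (fst D1 \<union> fst D2)" using D binary_dm_finite by simp
  obtain D3 where D3: "binary_dm D3" "ss_class D3 = c" "fst D3 \<inter> (fst D1 \<union> fst D2) = {}"
    "even_ss D \<longrightarrow> even_ss D3" unfolding c(2) by (rule disjoint_representative[OF c(1) fin])
  have disj: "fst D2 \<inter> fst D3 = {}" "(fst D1 \<union> fst D2) \<inter> fst D3 = {}" "fst D1 \<inter> (fst D2 \<union> fst D3) = {}"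
    using D(3) D3(3) by blast+
  have "cmult (cmult a b) c = ss_class (dsum (dsum D1 D2) D3)"
    unfolding D(6) D3(2)[symmetric] using disj
    by (intro cmult_ss_class binary_dm_set_system D3(1) binary_dm_dsum D) auto
  moreover have "cmult b c = ss_class (dsum D2 D3)"
    unfolding D(5) D3(2)[symmetric] by (intro cmult_ss_class binary_dm_set_system D D3(1) disj)
  moreover have "cmult a (ss_class (dsum D2 D3)) = ss_class (dsum D1 (dsum D2 D3))"
    unfolding D(4) using disj
    by (intro cmult_ss_class binary_dm_set_system D D3(1) binary_dm_dsum) auto
  ultimately show ?thesis by (simp add: dsum_assoc)
qed

lemma cmult_cunit:
  assumes "a \<in> BDM" shows "cmult cunit a = a" "cmult a cunit = a"
proof -
  obtain D where D: "binary_dm D" "a = ss_class D" by (rule BDM_E[OF assms])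
  show "cmult cunit a = a" "cmult a cunit = a" unfolding cunit_def D(2)
    using binary_dm_set_system[OF D(1)] binary_dm_set_system[OF binary_dm_empty_ss]
    by (simp_all add: cmult_ss_class dsum_empty_ss)
qed

lemma deg_cmult:
  assumes "a \<in> BDM" "b \<in> BDM" shows "deg (cmult a b) = deg a + deg b"
proof -
  obtain D1 D2 where D: "binary_dm D1" "binary_dm D2" "fst D1 \<inter> fst D2 = {}" "a = ss_class D1" "b = ss_class D2"
    "cmult a b = ss_class (dsum D1 D2)" by (rule two_representatives[OF assms])
  then show ?thesis
    using binary_dm_dsum[OF D(1-3)] binary_dm_finite
    by (simp add: deg_ss_class binary_dm_set_system card_Un_disjoint)
qed

text \<open>Connectedness of the grading. It supplies the base case of every recursion for the
  antipode.\<close>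

lemma deg_0_iff:
  assumes "c \<in> BDM" shows "deg c = 0 \<longleftrightarrow> c = cunit"
proof -
  obtain D where D: "binary_dm D" "c = ss_class D" by (rule BDM_E[OF assms])
  have "deg cunit = 0" unfolding cunit_def
    using deg_ss_class[OF binary_dm_set_system[OF binary_dm_empty_ss]] by simp
  moreover have "c = cunit" if "deg c = 0"
  proof -
    have "fst D = {}"
      using that binary_dm_finite[OF D(1)] unfolding D(2) deg_ss_class[OF binary_dm_set_system[OF D(1)]] by simp
    then show ?thesis using binary_dm_fst_empty[OF D(1)] D(2) by (simp add: cunit_def)
  qed
  ultimately show ?thesis by blast
qed

subsection \<open>Comultiplication and antipode\<close>

definition split_class :: "ssys \<Rightarrow> nat set \<Rightarrow> cls \<times> cls" where
  "split_class D A = (ss_class (restr D A), ss_class (restr D (fst D - A)))"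

lemma split_class_image:
  assumes "binary_dm D" "inj_on f (fst D)" "A \<subseteq> fst D"
  shows "split_class (ss_image f D) (f ` A) = split_class D A"
proof -
  have cls: "ss_class (restr (ss_image f D) (f ` B)) = ss_class (restr D B)" if B: "B \<subseteq> fst D" for B
    unfolding restr_image[OF assms(1,2) B]
    using binary_dm_set_system[OF binary_dm_restr[OF assms(1) B]] fst_restr[OF assms(1) B]
      inj_on_subset[OF assms(2) B] by (intro ss_class_image) simp_all
  have "f ` fst D - f ` A = f ` (fst D - A)" using inj_on_image_set_diff[OF assms(2) _ assms(3), of "fst D"] by simp
  then show ?thesis using cls[OF assms(3)] cls[of "fst D - A"] by (simp add: split_class_def)
qed

text \<open>\<open>comult\<close> is evaluated on the representative picked by \<open>rep\<close>.
  The relabeling from \<open>D\<close> to it induces a bijection of subsets that preserves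
  \<open>split_class\<close>, so the count may be made in any representative.\<close>

lemma comult_ss_class:
  assumes D: "binary_dm D"
  shows "comult (ss_class D) p = of_nat (card {A \<in> Pow (fst D). split_class D A = p})"
proof -
  obtain f where f: "inj_on f (fst D)" "rep (ss_class D) = ss_image f D"
    by (rule rep_ss_class[OF binary_dm_set_system[OF D]])
  let ?X = "{A \<in> Pow (fst D). split_class D A = p}"
  have inj: "inj_on ((`) f) ?X" by (rule inj_on_subset[OF inj_on_image_Pow[OF f(1)]]) auto
  have img: "(`) f ` ?X = {A \<in> Pow (f ` fst D). split_class (ss_image f D) A = p}"
  proof (intro Set.set_eqI iffI)
    fix W assume "W \<in> (`) f ` ?X"
    then show "W \<in> {A \<in> Pow (f ` fst D). split_class (ss_image f D) A = p}"
      using split_class_image[OF D f(1)] by auto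
  next
    fix W assume W: "W \<in> {A \<in> Pow (f ` fst D). split_class (ss_image f D) A = p}"
    then obtain A where A: "A \<subseteq> fst D" "W = f ` A" by (auto elim: subset_imageE)
    then have "A \<in> ?X" using W split_class_image[OF D f(1)] by auto
    then show "W \<in> (`) f ` ?X" using A(2) by blast
  qed
  have "card {A \<in> Pow (f ` fst D). split_class (ss_image f D) A = p} = card ?X"
    unfolding img[symmetric] by (rule card_image[OF inj])
  moreover have "comult (ss_class D) p = of_nat (card {A \<in> Pow (f ` fst D). split_class (ss_image f D) A = p})"
    unfolding comult_def f(2) split_class_def fst_ss_image
    by (intro arg_cong[where f = of_nat] arg_cong[where f = card] Collect_cong) (auto simp: prod_eq_iff)
  ultimately show ?thesis by simp
qed

lemma comult_eq_sum:
  assumes D: "binary_dm D"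
  shows "comult (ss_class D) p = (\<Sum>A\<in>Pow (fst D). ind p (split_class D A))"
proof -
  have fin: "finite (Pow (fst D))" using binary_dm_finite[OF D] by simp
  have "of_nat (card {A \<in> Pow (fst D). split_class D A = p}) =
      (\<Sum>A\<in>Pow (fst D). if split_class D A = p then 1 else 0 :: complex)"
    by (simp add: sum.inter_filter[OF fin, symmetric])
  then show ?thesis unfolding comult_ss_class[OF D] ind_def .
qed

lemma supp_comult:
  assumes D: "binary_dm D"
  shows "supp (comult (ss_class D)) = split_class D ` Pow (fst D)"
proof -
  have "finite {A \<in> Pow (fst D). split_class D A = p}" for p using binary_dm_finite[OF D] by simp
  then have eq: "comult (ss_class D) p \<noteq> 0 \<longleftrightarrow> (\<exists>A. A \<in> Pow (fst D) \<and> split_class D A = p)" for p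
    unfolding comult_ss_class[OF D] by (subst of_nat_eq_0_iff, subst card_0_eq) auto
  show ?thesis unfolding supp_def eq by blast
qed

text \<open>The coefficient of a basis tensor is the size of its fibre under
  \<open>split_class D\<close>. Grouping by fibres turns each axiom on the comultiplication into a
  statement on sums over subsets.\<close>

lemma sum_comult:
  assumes D: "binary_dm D"
  shows "(\<Sum>p\<in>supp (comult (ss_class D)). comult (ss_class D) p * F p) = (\<Sum>A\<in>Pow (fst D). F (split_class D A))"
proof -
  have fin: "finite (Pow (fst D))" using binary_dm_finite[OF D] by simp
  have "(\<Sum>A\<in>Pow (fst D). F (split_class D A)) =
     (\<Sum>p\<in>split_class D ` Pow (fst D). \<Sum>A\<in>{A \<in> Pow (fst D). split_class D A = p}. F (split_class D A))"
    by (rule sum.image_gen[OF fin])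
  also have "\<dots> = (\<Sum>p\<in>split_class D ` Pow (fst D). of_nat (card {A \<in> Pow (fst D). split_class D A = p}) * F p)"
    by (intro sum.cong refl) simp
  finally show ?thesis unfolding supp_comult[OF D] comult_ss_class[OF D] by simp
qed

lemma sum_comult':
  assumes D: "binary_dm D"
  shows "(\<Sum>p\<in>supp (comult (ss_class D)). comult (ss_class D) p * F p * G p) =
    (\<Sum>A\<in>Pow (fst D). F (split_class D A) * G (split_class D A))"
  using sum_comult[OF D, of "\<lambda>p. F p * G p"] by (simp add: mult.assoc)

lemma deg_restr:
  assumes "binary_dm D" "A \<subseteq> fst D" shows "deg (ss_class (restr D A)) = card A"
  using deg_ss_class[OF binary_dm_set_system[OF binary_dm_restr[OF assms]]] fst_restr[OF assms] by simp

lemma restr_empty: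
  assumes "binary_dm D" shows "restr D {} = empty_ss"
  using binary_dm_fst_empty[OF binary_dm_restr[OF assms]] fst_restr[OF assms] by simp

lemma split_class_BDM:
  assumes "binary_dm D" "A \<subseteq> fst D" shows "split_class D A \<in> BDM \<times> BDM"
  using assms by (auto simp: split_class_def intro!: BDM_I binary_dm_restr)

lemma split_class_BDM_even:
  assumes "binary_dm D" "even_ss D" "A \<subseteq> fst D" shows "split_class D A \<in> BDM_even \<times> BDM_even"
  using assms by (auto simp: split_class_def intro!: BDM_even_I binary_dm_restr even_ss_restr binary_dm_set_system)

lemma in_span_comult:
  assumes "c \<in> BDM" shows "in_span (BDM \<times> BDM) (comult c)"
proof -
  obtain D where D: "binary_dm D" "c = ss_class D" by (rule BDM_E[OF assms])
  show ?thesis unfolding in_span_def D(2) supp_comult[OF D(1)]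
    using binary_dm_finite[OF D(1)] split_class_BDM[OF D(1)] by blast
qed

lemma in_span_comult_even:
  assumes "c \<in> BDM_even" shows "in_span (BDM_even \<times> BDM_even) (comult c)"
proof -
  obtain D where D: "binary_dm D" "even_ss D" "c = ss_class D" by (rule BDM_even_E[OF assms])
  show ?thesis unfolding in_span_def D(3) supp_comult[OF D(1)]
    using binary_dm_finite[OF D(1)] split_class_BDM_even[OF D(1,2)] by blast
qed

lemma deg_comult:
  assumes "c \<in> BDM" "p \<in> supp (comult c)" shows "deg (fst p) + deg (snd p) = deg c"
proof -
  obtain D where D: "binary_dm D" "c = ss_class D" by (rule BDM_E[OF assms(1)])
  obtain A where A: "A \<subseteq> fst D" "p = split_class D A" using assms(2) unfolding D(2) supp_comult[OF D(1)] by blast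
  have "card A + card (fst D - A) = card (fst D)"
    using A(1) binary_dm_finite[OF D(1)] by (simp add: card_Diff_subset finite_subset card_mono)
  then show ?thesis using A deg_restr[OF D(1)] deg_ss_class[OF binary_dm_set_system[OF D(1)]]
    by (simp add: split_class_def D(2))
qed

text \<open>Both sides sum the same function over the ordered partitions of the ground set into
  three possibly empty blocks.\<close>

lemma coassoc:
  assumes "c \<in> BDM"
  shows "(\<Sum>p\<in>supp (comult c). comult c p * comult (fst p) (a, b) * ind d (snd p)) =
    (\<Sum>p\<in>supp (comult c). comult c p * ind a (fst p) * comult (snd p) (b, d))"
proof -
  obtain D where D: "binary_dm D" "c = ss_class D" by (rule BDM_E[OF assms])
  let ?E = "fst D" and ?c = "\<lambda>A. ss_class (restr D A)"
  define g where "g A B C = ind a (?c A) * ind b (?c B) * ind d (?c C)" for A B C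
  have fin: "finite ?E" by (rule binary_dm_finite[OF D(1)])
  have ind_pair: "ind (x, y) (s, t) = ind x s * ind y t" for x y s t :: cls by (simp add: ind_def)
  have inner: "comult (?c A) (x, y) = (\<Sum>B\<in>Pow A. ind x (?c B) * ind y (?c (A - B)))"
    if "A \<subseteq> ?E" for A x y
    unfolding comult_eq_sum[OF binary_dm_restr[OF D(1) that]] fst_restr[OF D(1) that] split_class_def ind_pair
    by (intro sum.cong refl) (simp add: restr_restr[OF D(1) _ that])
  have "(\<Sum>p\<in>supp (comult c). comult c p * comult (fst p) (a, b) * ind d (snd p))
      = (\<Sum>A\<in>Pow ?E. \<Sum>B\<in>Pow A. g B (A - B) (?E - A))"
    unfolding D(2) sum_comult'[OF D(1)] split_class_def
    by (intro sum.cong refl) (simp add: inner g_def sum_distrib_right)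
  also have "\<dots> = (\<Sum>(A, B)\<in>Sigma (Pow ?E) Pow. g B (A - B) (?E - A))"
    using fin by (intro sum.Sigma) (auto intro: finite_subset)
  \<comment> \<open>A nested pair with \<open>B\<close> inside \<open>A\<close> has the blocks
    \<open>B\<close>, \<open>A - B\<close>, \<open>?E - A\<close>. The second enumeration chooses
    the first block and then the second one from the rest.\<close>
  also have "\<dots> = (\<Sum>(A, B)\<in>Sigma (Pow ?E) (\<lambda>A. Pow (?E - A)). g A B (?E - A - B))"
    by (rule sum.reindex_bij_witness[of _ "\<lambda>(A, B). (A \<union> B, A)" "\<lambda>(A, B). (B, A - B)"])
      (auto intro!: arg_cong[where f = "g _ _"])
  also have "\<dots> = (\<Sum>A\<in>Pow ?E. \<Sum>B\<in>Pow (?E - A). g A B (?E - A - B))"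
    using fin by (intro sum.Sigma[symmetric]) auto
  also have "\<dots> = (\<Sum>p\<in>supp (comult c). comult c p * ind a (fst p) * comult (snd p) (b, d))"
    unfolding D(2) sum_comult'[OF D(1)] split_class_def
    by (intro sum.cong refl) (simp add: inner g_def sum_distrib_left mult.assoc)
  finally show ?thesis .
qed

lemma counit_restr:
  assumes "binary_dm D" "A \<subseteq> fst D"
  shows "counit (ss_class (restr D A)) = (if A = {} then 1 else 0)"
  using deg_restr[OF assms] finite_subset[OF assms(2) binary_dm_finite[OF assms(1)]] by (auto simp: counit_def)

lemma counit_left:
  assumes "c \<in> BDM"
  shows "(\<Sum>p\<in>supp (comult c). comult c p * counit (fst p) * ind b (snd p)) = ind c b"
proof -
  obtain D where D: "binary_dm D" "c = ss_class D" by (rule BDM_E[OF assms])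
  have "(\<Sum>A\<in>Pow (fst D). counit (ss_class (restr D A)) * ind b (ss_class (restr D (fst D - A))))
      = (\<Sum>A\<in>Pow (fst D). if A = {} then ind b (ss_class (restr D (fst D))) else 0)"
    by (intro sum.cong refl) (auto simp: counit_restr[OF D(1)])
  also have "\<dots> = ind c b" using binary_dm_finite[OF D(1)] by (simp add: restr_self D(2) ind_def)
  finally show ?thesis unfolding D(2) sum_comult'[OF D(1)] by (simp add: split_class_def)
qed

lemma comult_commute:
  assumes "c \<in> BDM" shows "comult c (a, b) = comult c (b, a)"
proof -
  obtain D where D: "binary_dm D" "c = ss_class D" by (rule BDM_E[OF assms])
  show ?thesis unfolding D(2) comult_eq_sum[OF D(1)]
    by (rule sum.reindex_bij_witness[of _ "\<lambda>A. fst D - A" "\<lambda>A. fst D - A"])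
      (auto simp: ind_def split_class_def double_diff)
qed

text \<open>Swapping the tensor factors permutes the support and keeps coefficients. Through it the
  right-hand counit and antipode identities follow from the left-hand ones.\<close>

lemma sum_comult_flip:
  assumes "c \<in> BDM"
  shows "(\<Sum>p\<in>supp (comult c). comult c p * F (fst p) (snd p)) = (\<Sum>p\<in>supp (comult c). comult c p * F (snd p) (fst p))"
  by (rule sum.reindex_bij_witness[of _ prod.swap prod.swap])
    (auto simp: supp_def comult_commute[OF assms])

lemma counit_right:
  assumes "c \<in> BDM"
  shows "(\<Sum>p\<in>supp (comult c). comult c p * ind a (fst p) * counit (snd p)) = ind c a"
  using counit_left[OF assms, of a] sum_comult_flip[OF assms, of "\<lambda>x y. ind a x * counit y"]
  by (simp add: mult.assoc mult.commute mult.left_commute)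

text \<open>A subset of a disjoint union is uniquely \<open>A \<union> B\<close>, and the
  restrictions to it and to its complement are direct sums of restrictions of the summands. The
  double sum over \<open>A\<close> and \<open>B\<close> is the product in the tensor square.\<close>

lemma comult_cmult:
  assumes "a \<in> BDM" "b \<in> BDM" shows "comult (cmult a b) = tmult cmult (comult a) (comult b)"
proof
  fix r
  obtain D1 D2 where D: "binary_dm D1" "binary_dm D2" "fst D1 \<inter> fst D2 = {}" "a = ss_class D1" "b = ss_class D2"
    "cmult a b = ss_class (dsum D1 D2)" by (rule two_representatives[OF assms])
  let ?E1 = "fst D1" and ?E2 = "fst D2"
  let ?m = "\<lambda>p q. (cmult (fst p) (fst q), cmult (snd p) (snd q))"
  have split: "split_class (dsum D1 D2) (A \<union> B) = ?m (split_class D1 A) (split_class D2 B)"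
    if AB: "A \<subseteq> ?E1" "B \<subseteq> ?E2" for A B
  proof -
    have *: "ss_class (restr (dsum D1 D2) (A \<union> B)) = cmult (ss_class (restr D1 A)) (ss_class (restr D2 B))"
      if AB: "A \<subseteq> ?E1" "B \<subseteq> ?E2" for A B
    proof -
      have "fst (restr D1 A) \<inter> fst (restr D2 B) = {}"
        using fst_restr[OF D(1) AB(1)] fst_restr[OF D(2) AB(2)] AB D(3) by auto
      then show ?thesis unfolding restr_dsum[OF D(1-3) AB]
        by (intro cmult_ss_class[symmetric] binary_dm_set_system binary_dm_restr D AB)
    qed
    have "?E1 \<union> ?E2 - (A \<union> B) = (?E1 - A) \<union> (?E2 - B)" using AB D(3) by blast
    then show ?thesis using *[OF AB] *[of "?E1 - A" "?E2 - B"] by (simp add: split_class_def)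
  qed
  have "comult (cmult a b) r = (\<Sum>C\<in>Pow (?E1 \<union> ?E2). ind r (split_class (dsum D1 D2) C))"
    unfolding D(6) comult_eq_sum[OF binary_dm_dsum[OF D(1-3)]] by simp
  also have "\<dots> = (\<Sum>(A, B)\<in>Pow ?E1 \<times> Pow ?E2. ind r (split_class (dsum D1 D2) (A \<union> B)))"
    using D(3)
    by (intro sum.reindex_bij_witness[of _ "\<lambda>(A, B). A \<union> B" "\<lambda>C. (C \<inter> ?E1, C \<inter> ?E2)"])
      (auto simp flip: Int_Un_distrib simp: Int_absorb2)
  also have "\<dots> = (\<Sum>(A, B)\<in>Pow ?E1 \<times> Pow ?E2. ind r (?m (split_class D1 A) (split_class D2 B)))"
    by (intro sum.cong refl) (auto simp: split)
  also have "\<dots> = (\<Sum>A\<in>Pow ?E1. \<Sum>B\<in>Pow ?E2. ind r (?m (split_class D1 A) (split_class D2 B)))"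
    by (simp add: sum.cartesian_product)
  also have "\<dots> = (\<Sum>p\<in>supp (comult a). comult a p * (\<Sum>q\<in>supp (comult b). comult b q * ind r (?m p q)))"
    unfolding D(4,5) sum_comult[OF D(1)] sum_comult[OF D(2)] ..
  also have "\<dots> = tmult cmult (comult a) (comult b) r"
    unfolding tmult_def sum_distrib_left
    by (intro sum.cong refl) (auto simp: ind_def prod_eq_iff)
  finally show "comult (cmult a b) r = tmult cmult (comult a) (comult b) r" .
qed

lemma deg_cunit: "deg cunit = 0"
  using deg_0_iff[OF cunit_BDM] by simp

lemma comult_cunit: "comult cunit = ind (cunit, cunit)"
proof
  fix p
  show "comult cunit p = ind (cunit, cunit) p"
    unfolding cunit_def comult_eq_sum[OF binary_dm_empty_ss]
    by (auto simp: ind_def split_class_def restr_empty[OF binary_dm_empty_ss])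
qed

section \<open>The antipode by recursion on the degree\<close>

lemma lmult_cunit:
  assumes "in_span BDM y" shows "lmult cmult y cunit = y"
proof
  fix z
  have "lmult cmult y cunit z = (\<Sum>a\<in>supp y. if a = z then y a else 0)"
    unfolding lmult_def using assms by (intro sum.cong refl) (auto simp: in_span_def cmult_cunit)
  also have "\<dots> = y z" using assms by (simp add: in_span_def supp_def)
  finally show "lmult cmult y cunit z = y z" .
qed

lemma lmult_eq_rmult:
  assumes "in_span BDM y" "b \<in> BDM" shows "lmult cmult y b z = rmult cmult b y z"
  unfolding lmult_def rmult_def using assms
  by (intro sum.cong refl) (auto simp: in_span_def cmult_commute subset_iff)

lemma in_span_ind: "a \<in> B \<Longrightarrow> in_span B (ind a)"
  by (auto simp: in_span_def supp_def ind_def intro: finite_subset[of _ "{a}"])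

lemma in_span_lmult:
  assumes "in_span B y" "b \<in> B" "\<And>a b. a \<in> B \<Longrightarrow> b \<in> B \<Longrightarrow> m a b \<in> B"
  shows "in_span B (lmult m y b)"
proof -
  have "supp (lmult m y b) \<subseteq> (\<lambda>a. m a b) ` supp y"
  proof
    fix z assume "z \<in> supp (lmult m y b)"
    then have "\<exists>a\<in>supp y. m a b = z"
      unfolding supp_def[of "lmult m y b"] lmult_def by (auto intro: ccontr dest: sum.neutral)
    then show "z \<in> (\<lambda>a. m a b) ` supp y" by blast
  qed
  moreover have "finite ((\<lambda>a. m a b) ` supp y)" "(\<lambda>a. m a b) ` supp y \<subseteq> B"
    using assms by (auto simp: in_span_def)
  ultimately show ?thesis unfolding in_span_def by (meson finite_subset subset_trans)
qed

lemma in_span_neg_sum: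
  assumes "finite P" "\<And>p. p \<in> P \<Longrightarrow> in_span B (f p)"
  shows "in_span B (\<lambda>z. - (\<Sum>p\<in>P. k p * f p z))"
proof -
  have "supp (\<lambda>z. - (\<Sum>p\<in>P. k p * f p z)) \<subseteq> (\<Union>p\<in>P. supp (f p))"
  proof
    fix z assume "z \<in> supp (\<lambda>z. - (\<Sum>p\<in>P. k p * f p z))"
    then have "(\<Sum>p\<in>P. k p * f p z) \<noteq> 0" by (simp add: supp_def)
    then obtain p where "p \<in> P" "k p * f p z \<noteq> 0" by (meson sum.neutral)
    then show "z \<in> (\<Union>p\<in>P. supp (f p))" by (auto simp: supp_def)
  qed
  moreover have "finite (\<Union>p\<in>P. supp (f p))" "(\<Union>p\<in>P. supp (f p)) \<subseteq> B"
    using assms by (auto simp: in_span_def)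
  ultimately show ?thesis unfolding in_span_def by (meson finite_subset subset_trans)
qed

text \<open>The part of the left antipode identity in which \<open>S\<close> is evaluated in smaller
  degree. \<open>S\<close> is a parameter because the same expression is applied to the constructed
  antipode and to an arbitrary one.\<close>

definition lower_sum :: "(cls \<Rightarrow> cls \<Rightarrow> complex) \<Rightarrow> cls \<Rightarrow> cls \<Rightarrow> complex" where
  "lower_sum S c z =
    (\<Sum>p\<in>{p \<in> supp (comult c). deg (fst p) < deg c}. comult c p * lmult cmult (S (fst p)) (snd p) z)"

text \<open>Stated for a general \<open>B\<close> closed under products and coproducts: with
  \<open>BDM\<close> it shows that the constructed antipode is well defined, with
  \<open>BDM_even\<close> that every antipode preserves the even part.\<close>

lemma in_span_lower_sum:
  assumes "B \<subseteq> BDM" "c \<in> B" "in_span (B \<times> B) (comult c)"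
    and "\<And>a b. a \<in> B \<Longrightarrow> b \<in> B \<Longrightarrow> cmult a b \<in> B"
    and "\<And>a. a \<in> B \<Longrightarrow> deg a < deg c \<Longrightarrow> in_span B (S a)"
  shows "in_span B (\<lambda>z. - lower_sum S c z)"
  unfolding lower_sum_def
proof (rule in_span_neg_sum)
  show "finite {p \<in> supp (comult c). deg (fst p) < deg c}" using assms(3) by (simp add: in_span_def)
  fix p assume p: "p \<in> {p \<in> supp (comult c). deg (fst p) < deg c}"
  then have "p \<in> B \<times> B" using assms(3) by (auto simp: in_span_def)
  then show "in_span B (lmult cmult (S (fst p)) (snd p))"
    using p by (intro in_span_lmult assms) auto
qed

text \<open>The term of full degree in the left antipode identity is S c, because the comultiplication
  is c (x) 1 plus terms whose first factor has smaller degree.\<close>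

lemma antipode_sum_split:
  assumes c: "c \<in> BDM" and deg: "deg c > 0" and S: "in_span BDM (S c)"
  shows "(\<Sum>p\<in>supp (comult c). comult c p * lmult cmult (S (fst p)) (snd p) z) = S c z + lower_sum S c z"
proof -
  obtain D where D: "binary_dm D" "c = ss_class D" by (rule BDM_E[OF c])
  have fin: "finite (fst D)" by (rule binary_dm_finite[OF D(1)])
  have degc: "deg c = card (fst D)" unfolding D(2) by (rule deg_ss_class[OF binary_dm_set_system[OF D(1)]])
  \<comment> \<open>The truncated sum is rewritten over the whole support so that
    \<open>sum_comult\<close> applies to the difference; proper subsets then drop out by
    cardinality.\<close>
  have low: "lower_sum S c z = (\<Sum>p\<in>supp (comult c). comult c p *
      (if deg (fst p) < deg c then lmult cmult (S (fst p)) (snd p) z else 0))"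
    unfolding lower_sum_def using in_span_comult[OF c]
    by (intro sum.mono_neutral_cong_left) (auto simp: in_span_def)
  have top: "split_class D (fst D) = (c, cunit)"
    by (simp add: split_class_def restr_self restr_empty[OF D(1)] D(2) cunit_def)
  have "(\<Sum>p\<in>supp (comult c). comult c p * lmult cmult (S (fst p)) (snd p) z) - lower_sum S c z
     = (\<Sum>p\<in>supp (comult c). comult c p *
        (if deg (fst p) < deg c then 0 else lmult cmult (S (fst p)) (snd p) z))"
    unfolding low sum_subtractf[symmetric] by (intro sum.cong refl) auto
  also have "\<dots> = (\<Sum>A\<in>Pow (fst D). if A = fst D then S c z else 0)"
    unfolding sum_comult[OF D(1), folded D(2)]
  proof (intro sum.cong refl)
    fix A assume "A \<in> Pow (fst D)"
    then have A: "A \<subseteq> fst D" by simp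
    have "deg (fst (split_class D A)) < deg c \<longleftrightarrow> A \<noteq> fst D"
      unfolding degc split_class_def fst_conv deg_restr[OF D(1) A]
      using A psubset_card_mono[OF fin, of A] by (cases "A = fst D") auto
    then show "(if deg (fst (split_class D A)) < deg c then 0
        else lmult cmult (S (fst (split_class D A))) (snd (split_class D A)) z) = (if A = fst D then S c z else 0)"
      by (auto simp: top lmult_cunit[OF S])
  qed
  also have "\<dots> = S c z" using fin by simp
  finally show ?thesis by (simp add: algebra_simps)
qed

text \<open>The usual recursion in a connected graded bialgebra, solving the left identity for its
  top term. The degree bound in the index set makes the recursive calls decrease.\<close>

function antipode :: "cls \<Rightarrow> cls \<Rightarrow> complex" where
  "antipode c = (if deg c = 0 then ind cunit else
    (\<lambda>z. - (\<Sum>p\<in>{p \<in> supp (comult c). deg (fst p) < deg c}.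
      comult c p * lmult cmult (antipode (fst p)) (snd p) z)))"
  by auto
termination by (relation "measure deg") auto

declare antipode.simps [simp del]

lemma antipode_cunit: "antipode cunit = ind cunit"
  by (simp add: antipode.simps[of cunit] deg_cunit)

lemma antipode_rec: "deg c > 0 \<Longrightarrow> antipode c = (\<lambda>z. - lower_sum antipode c z)"
  by (simp add: antipode.simps[of c] lower_sum_def)

lemma in_span_antipode: "c \<in> BDM \<Longrightarrow> in_span BDM (antipode c)"
proof (induction c rule: measure_induct_rule[of deg])
  case (less c)
  show ?case
  proof (cases "deg c = 0")
    case True
    then have "c = cunit" using deg_0_iff[OF less.prems] by blast
    then show ?thesis using in_span_ind[OF cunit_BDM] by (simp add: antipode_cunit)
  next
    case False
    then show ?thesis using antipode_rec[of c] less
      by (simp add: in_span_lower_sum in_span_comult cmult_BDM)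
  qed
qed

lemma sum_comult_cunit: "(\<Sum>p\<in>supp (comult cunit). comult cunit p * F p) = F (cunit, cunit)"
  by (simp add: comult_cunit supp_def ind_def)

lemma antipode_left:
  assumes c: "c \<in> BDM"
  shows "(\<Sum>p\<in>supp (comult c). comult c p * lmult cmult (antipode (fst p)) (snd p) z) = counit c * ind cunit z"
proof (cases "deg c = 0")
  case True
  then have "c = cunit" using deg_0_iff[OF c] by blast
  then show ?thesis
    by (simp add: sum_comult_cunit antipode_cunit lmult_cunit in_span_ind cunit_BDM counit_def deg_cunit)
next
  case False
  then show ?thesis
    using antipode_sum_split[where S = antipode and c = c, OF c _ in_span_antipode[OF c]] antipode_rec[of c] by (simp add: counit_def)
qed

lemma antipode_right:
  assumes c: "c \<in> BDM"
  shows "(\<Sum>p\<in>supp (comult c). comult c p * rmult cmult (fst p) (antipode (snd p)) z) = counit c * ind cunit z"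
proof -
  have "(\<Sum>p\<in>supp (comult c). comult c p * rmult cmult (fst p) (antipode (snd p)) z)
      = (\<Sum>p\<in>supp (comult c). comult c p * lmult cmult (antipode (snd p)) (fst p) z)"
  proof (intro sum.cong refl)
    fix p assume "p \<in> supp (comult c)"
    then have "fst p \<in> BDM" "snd p \<in> BDM" using in_span_comult[OF c] by (auto simp: in_span_def)
    then show "comult c p * rmult cmult (fst p) (antipode (snd p)) z =
        comult c p * lmult cmult (antipode (snd p)) (fst p) z"
      by (simp add: lmult_eq_rmult in_span_antipode)
  qed
  also have "\<dots> = counit c * ind cunit z"
    using antipode_left[OF c] sum_comult_flip[OF c, of "\<lambda>x y. lmult cmult (antipode y) x z"] by simp
  finally show ?thesis .
qed

lemma is_antipode_antipode: "is_antipode BDM cmult cunit comult counit antipode"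
  unfolding is_antipode_def using in_span_antipode antipode_left antipode_right by blast

text \<open>The claim concerns every antipode \<open>S\<close>, not just the constructed one. The
  left identity alone expresses \<open>S c\<close> through values of \<open>S\<close> in smaller
  degree, which the induction hypothesis places in the even part.\<close>

lemma antipode_even:
  assumes S: "is_antipode BDM cmult cunit comult counit S" and c: "c \<in> BDM_even"
  shows "in_span BDM_even (S c)"
  using c
proof (induction c rule: measure_induct_rule[of deg])
  case (less c)
  have c: "c \<in> BDM" using less.prems BDM_even_subset by blast
  have span: "in_span BDM (S c)" using S c unfolding is_antipode_def by blast
  have left: "(\<Sum>p\<in>supp (comult c). comult c p * lmult cmult (S (fst p)) (snd p) z) = counit c * ind cunit z" for z
    using S c unfolding is_antipode_def by blast
  show ?case
  proof (cases "deg c = 0")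
    case True
    then have u: "c = cunit" using deg_0_iff[OF c] by blast
    have "S cunit = ind cunit"
    proof
      fix z
      show "S cunit z = ind cunit z"
        using left[of z] span unfolding u by (simp add: sum_comult_cunit lmult_cunit counit_def deg_cunit)
    qed
    then show ?thesis using in_span_ind[OF cunit_BDM_even] u by simp
  next
    case False
    \<comment> \<open>In positive degree the counit vanishes, so the top term and the lower terms
      cancel.\<close>
    have "S c z = - lower_sum S c z" for z
      using antipode_sum_split[where S = S and c = c and z = z, OF c _ span] left[of z] False by (simp add: counit_def eq_neg_iff_add_eq_0)
    then have "S c = (\<lambda>z. - lower_sum S c z)" by blast
    moreover have "in_span BDM_even (\<lambda>z. - lower_sum S c z)"
      using less by (intro in_span_lower_sum BDM_even_subset in_span_comult_even cmult_BDM_even) auto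
    ultimately show ?thesis by simp
  qed
qed

theorem theorem3p8:
  shows "graded_comm_cocomm_hopf BDM cmult cunit comult counit deg \<and>
         hopf_subalgebra BDM_even BDM cmult cunit comult counit"
proof
  have counit_cmult: "counit (cmult a b) = counit a * counit b" if "a \<in> BDM" "b \<in> BDM" for a b
    using deg_cmult[OF that] by (simp add: counit_def)
  have counit_cunit: "counit cunit = 1" by (simp add: counit_def deg_cunit)
  have counit_pos: "counit c = 0" if "deg c > 0" for c using that by (simp add: counit_def)
  show "graded_comm_cocomm_hopf BDM cmult cunit comult counit deg"
    unfolding graded_comm_cocomm_hopf_def
    by (intro conjI ballI allI impI cunit_BDM cmult_BDM in_span_comult cmult_assoc cmult_cunit coassoc
        counit_left counit_right comult_cmult counit_cmult comult_cunit counit_cunit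
        exI[of _ antipode] is_antipode_antipode deg_cunit deg_cmult deg_comult counit_pos
        cmult_commute comult_commute)
  show "hopf_subalgebra BDM_even BDM cmult cunit comult counit"
    unfolding hopf_subalgebra_def
    by (intro conjI ballI allI impI BDM_even_subset cunit_BDM_even cmult_BDM_even in_span_comult_even antipode_even)
qed

end
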